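(* Let $X$ be a simplicial complex and let $U,V$ be subobjects of $X$ such that $X=U\cup V$ (that is, the underlying set of $X$ is the union of the underlying sets of $U$ and $V$, and the family of linked parts of $X$ is $!X=!U\cup{!V}$). Let $R$ be a subset of the underlying set of $X$ which is representative in $U$, in $V$ and in $U\cap V$. Then the following diagram of groupoids, whose arrows are induced by the inclusions, is a pushout in the category of small groupoids: $$\begin{array}{ccc}\Pi(U\cap V)|_R&\longrightarrow&\Pi U|_R\\ \downarrow&&\downarrow\\ \Pi V|_R&\longrightarrow&\Pi X|_R\end{array}$$
   Context: **Simplicial complexes.** A simplicial complex is a set $X$ equipped with a family $!X$ of finite subsets (the linked parts) which contains $\emptyset$ and all singletons and is closed under taking subsets. A map is a mapping of sets sending linked parts to linked parts. A finite subset of a product is linked iff all its projections are linked. A subobject $U$ of $X$ is a subset equipped with any simplicial complex structure such that $!U\subset{!X}$ (not necessarily the induced structure). $U\cap V$ is the intersection of the underlying sets with linked parts $!U\cap{!V}$; $U\cup V$ is the union of the underlying sets with linked parts $!U\cup{!V}$. The integral line $\mathbf{Z}$ is the set of integers whose linked parts are $\emptyset$, the singletons and the pairs $\{i,i+1\}$; $\mathbf{Z}^2$ has the product structure. **Paths.** A path in $X$ is a map $a:\mathbf{Z}\to X$ for which there are integers $\rho^-\le\rho^+$ (the interval $[\rho^-,\rho^+]$ is called a support) with $a$ constant on $]-\infty,\rho^-]$ and on $[\rho^+,\infty[$; its end points are $\partial^{\pm}a=a(\rho^{\pm})$. The standard support $\rho(a)=[\rho^-(a),\rho^+(a)]$ is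 the least support (and $[0,0]$ if $a$ is constant). If $\partial^+a=\partial^-b$, the concatenation $a+b$ is the path $c$ with $c(i)=a(i-\rho^-(b))$ for $i\le\rho^+(a)+\rho^-(b)$ and $c(i)=b(i-\rho^+(a))$ for $i\ge\rho^+(a)+\rho^-(b)$. The reversed path is $(-a)(i)=a(-i)$. **Fundamental groupoid.** Two paths $a,b$ in $X$ with the same end points $x=\partial^-a=\partial^-b$, $x'=\partial^+a=\partial^+b$ are 2-homotopic, $a\simeq_2b$, if there is a map $A:\mathbf{Z}^2\to X$ and integers $\rho^-\le\rho^+$, $\sigma^-\le\sigma^+$ such that $A(i,j)=x$ for $i\le\rho^-$, $A(i,j)=x'$ for $i\ge\rho^+$, $A(i,j)=a(i)$ for $j\le\sigma^-$ and $A(i,j)=b(i)$ for $j\ge\sigma^+$. The fundamental groupoid $\Pi X$ has the points of $X$ as objects and the $\simeq_2$-classes $[a]:\partial^-a\to\partial^+a$ of paths as arrows, with composition $[a]+[b]=[a+b]$, identities the classes of constant paths, and inverses $[-a]$. A map $f$ induces the functor $[a]\mapsto[fa]$. **Restriction.** For a subobject $Y$ of $X$ and a subset $R$ of $X$, $\Pi Y|_R$ is the full subgroupoid of $\Pi Y$ with objects the points of $R\cap Y$. $R$ is representative in $Y$ if it meets every path-component of $Y$, i.e. every class of the equivalence relation on $Y$ generated by $y\,!\,y'$ iff $\{y,y'\}\in{!Y}$. *)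

theory Defs
  imports "HOL-Library.FuncSet"
begin

record 'a scomplex =
  points :: "'a set"
  linked :: "'a set set"

definition simplicial_complex :: "'a scomplex \<Rightarrow> bool" where
  "simplicial_complex X \<longleftrightarrow>
     (\<forall>S\<in>linked X. finite S \<and> S \<subseteq> points X) \<and>
     {} \<in> linked X \<and>
     (\<forall>x\<in>points X. {x} \<in> linked X) \<and>
     (\<forall>S\<in>linked X. \<forall>T. T \<subseteq> S \<longrightarrow> T \<in> linked X)"

definition sc_map :: "'a scomplex \<Rightarrow> 'b scomplex \<Rightarrow> ('a \<Rightarrow> 'b) \<Rightarrow> bool" where
  "sc_map X Y f \<longleftrightarrow> f \<in> points X \<rightarrow> points Y \<and> (\<forall>S\<in>linked X. f ` S \<in> linked Y)"

definition sc_prod :: "'a scomplex \<Rightarrow> 'b scomplex \<Rightarrow> ('a \<times> 'b) scomplex" where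
  "sc_prod X Y =
     \<lparr>points = points X \<times> points Y,
      linked = {S. finite S \<and> S \<subseteq> points X \<times> points Y \<and> fst ` S \<in> linked X \<and> snd ` S \<in> linked Y}\<rparr>"

text \<open>A subobject need not carry the induced structure.\<close>

definition subobject :: "'a scomplex \<Rightarrow> 'a scomplex \<Rightarrow> bool" where
  "subobject U X \<longleftrightarrow>
     simplicial_complex U \<and> points U \<subseteq> points X \<and> linked U \<subseteq> linked X"

definition sc_inter :: "'a scomplex \<Rightarrow> 'a scomplex \<Rightarrow> 'a scomplex" where
  "sc_inter U V = \<lparr>points = points U \<inter> points V, linked = linked U \<inter> linked V\<rparr>"

definition sc_union :: "'a scomplex \<Rightarrow> 'a scomplex \<Rightarrow> 'a scomplex" where
  "sc_union U V = \<lparr>points = points U \<union> points V, linked = linked U \<union> linked V\<rparr>"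

definition int_line :: "int scomplex" where
  "int_line = \<lparr>points = UNIV, linked = {{}} \<union> {{i} | i. True} \<union> {{i, i + 1} | i. True}\<rparr>"

definition path_components :: "'a scomplex \<Rightarrow> 'a set set" where
  "path_components Y =
     points Y // {(y, y'). y \<in> points Y \<and> y' \<in> points Y \<and>
                          equivclp (\<lambda>u v. {u, v} \<in> linked Y) y y'}"

definition representative :: "'a set \<Rightarrow> 'a scomplex \<Rightarrow> bool" where
  "representative R Y \<longleftrightarrow> (\<forall>C\<in>path_components Y. R \<inter> C \<noteq> {})"

definition path_support :: "(int \<Rightarrow> 'a) \<Rightarrow> int \<Rightarrow> int \<Rightarrow> bool" where
  "path_support a m n \<longleftrightarrow> m \<le> n \<and> (\<forall>i\<le>m. a i = a m) \<and> (\<forall>i\<ge>n. a i = a n)"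

definition sc_path :: "'a scomplex \<Rightarrow> (int \<Rightarrow> 'a) \<Rightarrow> bool" where
  "sc_path X a \<longleftrightarrow> sc_map int_line X a \<and> (\<exists>m n. path_support a m n)"

definition std_support :: "(int \<Rightarrow> 'a) \<Rightarrow> int \<times> int" where
  "std_support a =
     (if \<exists>x. \<forall>i. a i = x then (0, 0)
      else THE p. path_support a (fst p) (snd p) \<and>
                  (\<forall>m n. path_support a m n \<longrightarrow> {fst p..snd p} \<subseteq> {m..n}))"

definition rho_minus :: "(int \<Rightarrow> 'a) \<Rightarrow> int" where
  "rho_minus a = fst (std_support a)"

definition rho_plus :: "(int \<Rightarrow> 'a) \<Rightarrow> int" where
  "rho_plus a = snd (std_support a)"

definition path_start :: "(int \<Rightarrow> 'a) \<Rightarrow> 'a" where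
  "path_start a = a (rho_minus a)"

definition path_end :: "(int \<Rightarrow> 'a) \<Rightarrow> 'a" where
  "path_end a = a (rho_plus a)"

definition path_concat :: "(int \<Rightarrow> 'a) \<Rightarrow> (int \<Rightarrow> 'a) \<Rightarrow> int \<Rightarrow> 'a" where
  "path_concat a b =
     (\<lambda>i. if i \<le> rho_plus a + rho_minus b then a (i - rho_minus b) else b (i - rho_plus a))"

definition homotopy2 :: "'a scomplex \<Rightarrow> ((int \<Rightarrow> 'a) \<times> (int \<Rightarrow> 'a)) set" where
  "homotopy2 X =
     {(a, b). sc_path X a \<and> sc_path X b \<and>
        path_start a = path_start b \<and> path_end a = path_end b \<and>
        (\<exists>A r s u v.
           sc_map (sc_prod int_line int_line) X A \<and> r \<le> s \<and> u \<le> v \<and>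
           (\<forall>i j. i \<le> r \<longrightarrow> A (i, j) = path_start a) \<and>
           (\<forall>i j. i \<ge> s \<longrightarrow> A (i, j) = path_end a) \<and>
           (\<forall>i j. j \<le> u \<longrightarrow> A (i, j) = a i) \<and>
           (\<forall>i j. j \<ge> v \<longrightarrow> A (i, j) = b i))}"

text \<open>Composition is written in diagrammatic order: \<open>Comp G f g\<close> is \<open>f\<close> followed by \<open>g\<close>.\<close>

record ('o, 'm) gpd =
  Obj :: "'o set"
  Arr :: "'m set"
  Dom :: "'m \<Rightarrow> 'o"
  Cod :: "'m \<Rightarrow> 'o"
  Ide :: "'o \<Rightarrow> 'm"
  Comp :: "'m \<Rightarrow> 'm \<Rightarrow> 'm"

definition groupoid :: "('o, 'm) gpd \<Rightarrow> bool" where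
  "groupoid G \<longleftrightarrow>
     Dom G \<in> Arr G \<rightarrow> Obj G \<and> Cod G \<in> Arr G \<rightarrow> Obj G \<and>
     (\<forall>x\<in>Obj G. Ide G x \<in> Arr G \<and> Dom G (Ide G x) = x \<and> Cod G (Ide G x) = x) \<and>
     (\<forall>f\<in>Arr G. \<forall>g\<in>Arr G. Cod G f = Dom G g \<longrightarrow>
        Comp G f g \<in> Arr G \<and> Dom G (Comp G f g) = Dom G f \<and> Cod G (Comp G f g) = Cod G g) \<and>
     (\<forall>f\<in>Arr G. Comp G (Ide G (Dom G f)) f = f \<and> Comp G f (Ide G (Cod G f)) = f) \<and>
     (\<forall>f\<in>Arr G. \<forall>g\<in>Arr G. \<forall>h\<in>Arr G. Cod G f = Dom G g \<longrightarrow> Cod G g = Dom G h \<longrightarrow>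
        Comp G (Comp G f g) h = Comp G f (Comp G g h)) \<and>
     (\<forall>f\<in>Arr G. \<exists>g\<in>Arr G. Dom G g = Cod G f \<and> Cod G g = Dom G f \<and>
        Comp G f g = Ide G (Dom G f) \<and> Comp G g f = Ide G (Cod G f))"

text \<open>A functor is the pair of its object map and its arrow map; both are extensional, so that
  equality of functors is equality of pairs.\<close>

definition gpd_functor ::
  "('o, 'm) gpd \<Rightarrow> ('p, 'n) gpd \<Rightarrow> ('o \<Rightarrow> 'p) \<times> ('m \<Rightarrow> 'n) \<Rightarrow> bool" where
  "gpd_functor G H F \<longleftrightarrow>
     fst F \<in> Obj G \<rightarrow>\<^sub>E Obj H \<and> snd F \<in> Arr G \<rightarrow>\<^sub>E Arr H \<and>
     (\<forall>f\<in>Arr G. Dom H (snd F f) = fst F (Dom G f) \<and> Cod H (snd F f) = fst F (Cod G f)) \<and>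
     (\<forall>x\<in>Obj G. snd F (Ide G x) = Ide H (fst F x)) \<and>
     (\<forall>f\<in>Arr G. \<forall>g\<in>Arr G. Cod G f = Dom G g \<longrightarrow>
        snd F (Comp G f g) = Comp H (snd F f) (snd F g))"

text \<open>\<open>functor_comp G K F\<close> is the composite \<open>K \<circ> F\<close> of functors, where \<open>F\<close> starts at \<open>G\<close>.\<close>

definition functor_comp ::
  "('o, 'm) gpd \<Rightarrow> ('p \<Rightarrow> 'q) \<times> ('n \<Rightarrow> 'k) \<Rightarrow> ('o \<Rightarrow> 'p) \<times> ('m \<Rightarrow> 'n) \<Rightarrow> ('o \<Rightarrow> 'q) \<times> ('m \<Rightarrow> 'k)"
  where
  "functor_comp G K F = (compose (Obj G) (fst K) (fst F), compose (Arr G) (snd K) (snd F))"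

definition full_subgpd :: "('o, 'm) gpd \<Rightarrow> 'o set \<Rightarrow> ('o, 'm) gpd" where
  "full_subgpd G S =
     G\<lparr>Obj := S \<inter> Obj G, Arr := {f \<in> Arr G. Dom G f \<in> S \<and> Cod G f \<in> S}\<rparr>"

definition functor_restrict ::
  "('o, 'm) gpd \<Rightarrow> ('o \<Rightarrow> 'p) \<times> ('m \<Rightarrow> 'n) \<Rightarrow> ('o \<Rightarrow> 'p) \<times> ('m \<Rightarrow> 'n)" where
  "functor_restrict G F = (restrict (fst F) (Obj G), restrict (snd F) (Arr G))"

text \<open>The square with sides \<open>F : A \<rightarrow> B\<close>, \<open>G : A \<rightarrow> C\<close>, \<open>H : B \<rightarrow> E\<close>, \<open>K : C \<rightarrow> E\<close> is a pushout.
  HOL cannot quantify over types inside a definition, so the test groupoids \<open>D\<close> range over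
  those with objects in \<open>'p\<close> and arrows in \<open>'n\<close>. The full universal property is the
  statement with \<open>'p\<close> and \<open>'n\<close> left as free type variables.\<close>

definition gpd_pushout ::
  "'p itself \<Rightarrow> 'n itself \<Rightarrow>
   ('o1, 'm1) gpd \<Rightarrow> ('o2, 'm2) gpd \<Rightarrow> ('o3, 'm3) gpd \<Rightarrow> ('o4, 'm4) gpd \<Rightarrow>
   ('o1 \<Rightarrow> 'o2) \<times> ('m1 \<Rightarrow> 'm2) \<Rightarrow> ('o1 \<Rightarrow> 'o3) \<times> ('m1 \<Rightarrow> 'm3) \<Rightarrow>
   ('o2 \<Rightarrow> 'o4) \<times> ('m2 \<Rightarrow> 'm4) \<Rightarrow> ('o3 \<Rightarrow> 'o4) \<times> ('m3 \<Rightarrow> 'm4) \<Rightarrow> bool" where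
  "gpd_pushout _ _ A B C E F G H K \<longleftrightarrow>
     groupoid A \<and> groupoid B \<and> groupoid C \<and> groupoid E \<and>
     gpd_functor A B F \<and> gpd_functor A C G \<and> gpd_functor B E H \<and> gpd_functor C E K \<and>
     functor_comp A H F = functor_comp A K G \<and>
     (\<forall>(D :: ('p, 'n) gpd) P Q.
        groupoid D \<and> gpd_functor B D P \<and> gpd_functor C D Q \<and>
        functor_comp A P F = functor_comp A Q G \<longrightarrow>
        (\<exists>!T. gpd_functor E D T \<and> functor_comp B T H = P \<and> functor_comp C T K = Q))"

text \<open>An arrow is a class of paths. Operations on classes are unions over representatives, all
  of which give the same class; \<open>the_elem\<close> picks the end point shared by all paths of a class.\<close>

definition fundamental_gpd :: "'a scomplex \<Rightarrow> ('a, (int \<Rightarrow> 'a) set) gpd" where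
  "fundamental_gpd X =
     \<lparr>Obj = points X,
      Arr = {a. sc_path X a} // homotopy2 X,
      Dom = (\<lambda>\<alpha>. the_elem (path_start ` \<alpha>)),
      Cod = (\<lambda>\<alpha>. the_elem (path_end ` \<alpha>)),
      Ide = (\<lambda>x. homotopy2 X `` {\<lambda>_. x}),
      Comp = (\<lambda>\<alpha> \<beta>. \<Union>a\<in>\<alpha>. \<Union>b\<in>\<beta>. homotopy2 X `` {path_concat a b})\<rparr>"

definition fundamental_functor ::
  "'a scomplex \<Rightarrow> 'b scomplex \<Rightarrow> ('a \<Rightarrow> 'b) \<Rightarrow>
   ('a \<Rightarrow> 'b) \<times> ((int \<Rightarrow> 'a) set \<Rightarrow> (int \<Rightarrow> 'b) set)" where
  "fundamental_functor X Y f =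
     (restrict f (points X),
      \<lambda>\<alpha>\<in>Arr (fundamental_gpd X). \<Union>a\<in>\<alpha>. homotopy2 Y `` {f \<circ> a})"

definition fundamental_gpd_on :: "'a scomplex \<Rightarrow> 'a set \<Rightarrow> ('a, (int \<Rightarrow> 'a) set) gpd" where
  "fundamental_gpd_on Y R = full_subgpd (fundamental_gpd Y) R"

definition inclusion_functor_on ::
  "'a scomplex \<Rightarrow> 'a scomplex \<Rightarrow> 'a set \<Rightarrow>
   ('a \<Rightarrow> 'a) \<times> ((int \<Rightarrow> 'a) set \<Rightarrow> (int \<Rightarrow> 'a) set)" where
  "inclusion_functor_on Y X R =
     functor_restrict (fundamental_gpd_on Y R) (fundamental_functor Y X id)"

end

(* Because the linked parts of X are those of U together with those of V, every edge and every
   linked triple of X lies in U or in V; no subdivision argument is needed. A path is the word of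
   its vertices, and 2-homotopy is the relation on words generated by repeating a vertex and by
   replacing an edge x z by x y z when {x, y, z} is linked. Choose for every point a walk to R,
   inside the intersection of U and V whenever possible. Conjugating an edge by these walks gives
   an arrow over R in U or V, and the images of these arrows under a pair of compatible functors
   into D are a cocycle on the edges of X. The product of the cocycle along words is the unique
   induced functor. *)

theory Submission
  imports Defs
begin

section \<open>Walks and elementary moves\<close>

text \<open>The obstacle is at vertices outside \<open>R\<close>: a walk between points of
  \<open>R\<close> may pass from one piece to the other at a vertex where neither given functor has
  a value. Conjugation supplies a value there, but both sides must use the same walk to
  \<open>R\<close>. Over a common point of U and V that walk therefore has to lie in both, and this
  is what representativity in the intersection provides. Since linked parts of the intersection are
  the common linked parts, an edge linked in both pieces becomes an arrow of the corner groupoid,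
  where the given functors agree. An edge between common points that is linked in one piece only
  calls for no comparison. At points of \<open>R\<close> the chosen walks are trivial, so
  conjugation fixes every walk with ends in \<open>R\<close> and the induced functor restricts to
  the given ones exactly, not just up to conjugation. Linked triples suffice to describe homotopies
  because the four corners of a unit square of the plane form one linked part, diagonals included:
  each square splits into two triangles.\<close>

definition walk :: "'a scomplex \<Rightarrow> 'a list \<Rightarrow> bool" where
  "walk X w \<longleftrightarrow> w \<noteq> [] \<and> set w \<subseteq> points X \<and> successively (\<lambda>x y. {x, y} \<in> linked X) w"

text \<open>The vertices in \<open>tri\<close> may coincide. With \<open>z = x\<close> the rule
  relates \<open>x, x\<close> to \<open>x, y, x\<close>, so together with \<open>dup\<close> it
  cancels backtracking along an edge. Both rules lengthen the word; shortening comes from the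
  equivalence closure.\<close>

inductive move :: "'a scomplex \<Rightarrow> 'a list \<Rightarrow> 'a list \<Rightarrow> bool" for X where
  dup: "move X (xs @ x # ys) (xs @ x # x # ys)"
| tri: "{x, y, z} \<in> linked X \<Longrightarrow> move X (xs @ x # z # ys) (xs @ x # y # z # ys)"

abbreviation weq :: "'a scomplex \<Rightarrow> 'a list \<Rightarrow> 'a list \<Rightarrow> bool" where
  "weq X \<equiv> equivclp (move X)"

lemma equivclp_map:
  assumes "equivclp r a b" and "\<And>x y. r x y \<Longrightarrow> equivclp q (f x) (f y)"
  shows "equivclp q (f a) (f b)"
  using assms(1)
proof induction
  case base
  then show ?case by simp
next
  case (step y z)
  then have "equivclp q (f y) (f z)" using assms(2) equivclp_sym by metis
  with step.IH show ?case by (rule equivclp_trans)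
qed

lemma equivclp_invariant:
  assumes "equivclp r a b" and "\<And>x y. r x y \<Longrightarrow> f x = f y"
  shows "f a = f b"
  using assms(1)
proof induction
  case (step y z)
  then show ?case using assms(2) by metis
qed simp

lemma linked_subset:
  assumes "simplicial_complex X" "S \<in> linked X" "T \<subseteq> S"
  shows "T \<in> linked X"
  using assms by (simp add: simplicial_complex_def)

lemma linked_points:
  assumes "simplicial_complex X" "S \<in> linked X" "x \<in> S"
  shows "x \<in> points X"
  using assms by (auto simp: simplicial_complex_def)

lemma linked_single:
  assumes "simplicial_complex X" "x \<in> points X"
  shows "{x} \<in> linked X"
  using assms by (simp add: simplicial_complex_def)

lemma weq_append: "weq X u v \<Longrightarrow> weq X (xs @ u @ ys) (xs @ v @ ys)"
proof (erule equivclp_map[where f = "\<lambda>w. xs @ w @ ys"])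
  fix x y assume "move X x y"
  then have "move X (xs @ x @ ys) (xs @ y @ ys)"
  proof cases
    case (dup xs' x ys')
    then show ?thesis using move.dup[of X "xs @ xs'" x "ys' @ ys"] by simp
  next
    case (tri x y z xs' ys')
    then show ?thesis using move.tri[of x y z X "xs @ xs'" "ys' @ ys"] by simp
  qed
  then show "weq X (xs @ x @ ys) (xs @ y @ ys)" by (rule r_into_equivclp)
qed

lemma weq_Cons: "weq X u v \<Longrightarrow> weq X (x # u) (x # v)"
  using weq_append[of X u v "[x]" "[]"] by simp

lemma weq_ends:
  assumes "weq X u v"
  shows "hd u = hd v" "last u = last v" "u = [] \<longleftrightarrow> v = []"
proof -
  have "(hd u, last u, u = []) = (hd v, last v, v = [])"
    by (rule equivclp_invariant[OF assms]) (auto elim!: move.cases simp: hd_append)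
  then show "hd u = hd v" "last u = last v" "u = [] \<longleftrightarrow> v = []" by auto
qed

text \<open>The glued word can be written as \<open>u @ tl v\<close> or as
  \<open>butlast u @ v\<close>. The first form exposes all of \<open>u\<close> to rewriting, the
  second all of \<open>v\<close>.\<close>

lemma weq_glue:
  assumes u: "weq X u u'" and v: "weq X v v'" and "u \<noteq> []" "v \<noteq> []" "last u = hd v"
  shows "weq X (u @ tl v) (u' @ tl v')"
proof -
  have eq: "w @ tl t = butlast w @ t" if "w \<noteq> []" "t \<noteq> []" "last w = hd t" for w t :: "'a list"
    using that by (cases t; cases w rule: rev_cases) auto
  have "weq X (u @ tl v) (u' @ tl v)" using weq_append[OF u, of "[]"] by simp
  also have "u' @ tl v = butlast u' @ v"
    by (rule eq) (use assms weq_ends[OF u] in auto)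
  also have "weq X \<dots> (butlast u' @ v')" using weq_append[OF v, of _ "[]"] by simp
  also have "butlast u' @ v' = u' @ tl v'"
    by (rule eq[symmetric]) (use assms weq_ends[OF u] weq_ends[OF v] in auto)
  finally show ?thesis .
qed

lemma walk_ne: "walk X w \<Longrightarrow> w \<noteq> []"
  by (simp add: walk_def)

lemma walk_ends:
  assumes "walk X w"
  shows "hd w \<in> points X" "last w \<in> points X"
  using assms hd_in_set[of w] last_in_set[of w] unfolding walk_def by blast+

lemma walk_single: "walk X [x] \<longleftrightarrow> x \<in> points X"
  by (simp add: walk_def)

lemma walk_pair:
  assumes "simplicial_complex X"
  shows "walk X [x, y] \<longleftrightarrow> {x, y} \<in> linked X"
  using linked_points[OF assms, of "{x, y}" x] linked_points[OF assms, of "{x, y}" y]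
  by (auto simp: walk_def)

lemma walk_Cons2:
  assumes "simplicial_complex X"
  shows "walk X (x # y # ys) \<longleftrightarrow> {x, y} \<in> linked X \<and> walk X (y # ys)"
  using linked_points[OF assms, of "{x, y}" x] linked_points[OF assms, of "{x, y}" y]
  by (auto simp: walk_def)

lemma walk_rev: "walk X (rev w) \<longleftrightarrow> walk X w"
proof -
  have "successively (\<lambda>x y. {y, x} \<in> linked X) w \<longleftrightarrow> successively (\<lambda>x y. {x, y} \<in> linked X) w"
    by (rule successively_cong) (simp_all add: insert_commute)
  then show ?thesis unfolding walk_def by simp
qed

lemma walk_glue:
  assumes "walk X u" "walk X v" "last u = hd v"
  shows "walk X (u @ tl v)"
proof -
  obtain y v' where v: "v = y # v'" using walk_ne[OF assms(2)] by (cases v) auto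
  show ?thesis using assms unfolding v
    by (auto simp: walk_def successively_append_iff successively_Cons)
qed

lemma walk_subobject:
  assumes "points U \<subseteq> points X" "linked U \<subseteq> linked X" "walk U w"
  shows "walk X w"
  using assms unfolding walk_def by (auto elim: successively_mono)

text \<open>All faces of a linked triple are edges, so the middle vertex can be inserted or deleted.
  Both directions are required because \<open>weq\<close> uses moves in either direction.\<close>

lemma move_walk:
  assumes X: "simplicial_complex X" and "move X u v"
  shows "walk X u \<longleftrightarrow> walk X v"
  using assms(2)
proof cases
  case (dup xs x ys)
  have "{x} \<in> linked X" if "x \<in> points X" using X that by (rule linked_single)
  then show ?thesis unfolding dup walk_def
    by (auto simp: successively_append_iff successively_Cons)
next
  case (tri x y z xs ys)
  have "{x, y} \<in> linked X" "{y, z} \<in> linked X" "{x, z} \<in> linked X" "y \<in> points X"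
    using linked_subset[OF X tri(3)] linked_points[OF X tri(3)] by auto
  then show ?thesis unfolding tri(1,2) walk_def
    by (auto simp: successively_append_iff successively_Cons)
qed

lemma weq_walk:
  assumes "simplicial_complex X" "weq X u v"
  shows "walk X u \<longleftrightarrow> walk X v"
  by (rule equivclp_invariant[OF assms(2)]) (rule move_walk[OF assms(1)])

lemma weq_dup: "weq X (xs @ x # x # ys) (xs @ x # ys)"
  by (rule converse_r_into_equivclp) (rule move.dup)

lemma weq_tri: "{x, y, z} \<in> linked X \<Longrightarrow> weq X (xs @ x # y # z # ys) (xs @ x # z # ys)"
  by (rule converse_r_into_equivclp) (rule move.tri)

text \<open>The innermost part \<open>y, x, y\<close> of the word is a triangle with two equal
  vertices. It collapses to \<open>y, y\<close> and then to \<open>y\<close>, which leaves the same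
  problem for a shorter walk.\<close>

lemma weq_rev_cancel:
  assumes X: "simplicial_complex X" and "walk X w"
  shows "weq X (rev w @ tl w) [last w]"
  using assms(2)
proof (induction w)
  case (Cons x w)
  show ?case
  proof (cases w)
    case (Cons y ys)
    with \<open>walk X (x # w)\<close> have "{x, y} \<in> linked X" "walk X w" using walk_Cons2[OF X] by auto
    then have "weq X (rev ys @ y # x # y # ys) (rev ys @ y # y # ys)"
      by (intro weq_tri) (simp add: insert_commute)
    also have "weq X \<dots> (rev ys @ y # ys)" by (rule weq_dup)
    also have "weq X \<dots> [last w]" using Cons.IH \<open>walk X w\<close> Cons by simp
    finally show ?thesis using Cons by simp
  qed simp
qed (simp add: walk_def)

lemma weq_cancel_rev:
  assumes X: "simplicial_complex X" and "walk X w"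
  shows "weq X (w @ tl (rev w)) [hd w]"
  using weq_rev_cancel[OF X, of "rev w"] assms(2) walk_rev[of X w] walk_ne[OF assms(2)]
  by (simp add: last_rev)

text \<open>The rung joining the two rows is pushed across one square at a time. The rows may have
  different ends, because in the induction the rung stands between two arbitrary intermediate
  vertices.\<close>

lemma ladder_weq:
  assumes X: "simplicial_complex X" and "length u = length v" "u \<noteq> []"
    and "\<And>i. Suc i < length u \<Longrightarrow> {u ! i, u ! Suc i, v ! i, v ! Suc i} \<in> linked X"
  shows "weq X (hd u # v) (u @ [last v])"
  using assms(2-)
proof (induction u arbitrary: v)
  case (Cons x u)
  then obtain x' v' where v: "v = x' # v'" by (cases v) auto
  show ?case
  proof (cases u)
    case Nil
    then show ?thesis using Cons.prems v \<open>u = []\<close> by (cases v') auto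
  next
    case (Cons y u')
    then obtain y' v'' where v': "v' = y' # v''" using Cons.prems(1) v by (cases v') auto
    have sq: "{x, y, x', y'} \<in> linked X"
      using Cons.prems(3)[of 0] v v' Cons by simp
    \<comment> \<open>The square is cut along the diagonal \<open>x, y'\<close>: the triangle
      \<open>x, x', y'\<close> removes \<open>x'\<close> and the triangle \<open>x, y, y'\<close>
      inserts \<open>y\<close>. The rung is then \<open>y, y'\<close>.\<close>
    have "weq X ([] @ x # x' # y' # v'') ([] @ x # y' # v'')"
      by (rule weq_tri) (rule linked_subset[OF X sq], blast)
    also have "weq X \<dots> ([] @ x # y # y' # v'')"
      by (rule equivclp_sym, rule weq_tri) (rule linked_subset[OF X sq], blast)
    also have "weq X \<dots> (x # u @ [last v'])"
    proof -
      have "weq X (hd u # v') (u @ [last v'])"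
      proof (rule Cons.IH)
        fix i assume "Suc i < length u"
        then show "{u ! i, u ! Suc i, v' ! i, v' ! Suc i} \<in> linked X"
          using Cons.prems(3)[of "Suc i"] v by simp
      qed (use Cons.prems v Cons in auto)
      from weq_Cons[OF this, of x] show ?thesis using v' Cons by simp
    qed
    finally show ?thesis using v v' by simp
  qed
qed simp

section \<open>Paths\<close>

lemma points_int_line: "points int_line = UNIV"
  by (simp add: int_line_def)

lemma int_line_linked: "S \<in> linked int_line \<longleftrightarrow> (\<exists>i. S \<subseteq> {i, i + 1})"
proof
  assume "\<exists>i. S \<subseteq> {i, i + 1}"
  then obtain i where "S \<in> Pow {i, i + 1}" by blast
  then have "S = {} \<or> S = {i} \<or> S = {i + 1} \<or> S = {i, i + 1}"
    by (simp add: Pow_insert) blast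
  then show "S \<in> linked int_line" unfolding int_line_def by auto
qed (auto simp: int_line_def)

lemma sc_map_int_line:
  assumes X: "simplicial_complex X"
  shows "sc_map int_line X a \<longleftrightarrow> (\<forall>i. {a i, a (i + 1)} \<in> linked X)"
proof
  assume "sc_map int_line X a"
  then have "a ` {i, i + 1} \<in> linked X" for i
    unfolding sc_map_def using int_line_linked by blast
  then show "\<forall>i. {a i, a (i + 1)} \<in> linked X" by simp
next
  assume *: "\<forall>i. {a i, a (i + 1)} \<in> linked X"
  have "a ` S \<in> linked X" if "S \<in> linked int_line" for S
  proof -
    from that obtain i where "S \<subseteq> {i, i + 1}" unfolding int_line_linked by blast
    then have "a ` S \<subseteq> {a i, a (i + 1)}" by blast
    with X * show ?thesis using linked_subset by metis
  qed
  moreover have "a i \<in> points X" for i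
    using linked_points[OF X, of "{a i, a (i + 1)}"] * by simp
  ultimately show "sc_map int_line X a" unfolding sc_map_def by simp
qed

text \<open>The maximal linked parts of the product are the unit squares, since a linked part
  projects into a unit interval in each coordinate.\<close>

lemma sc_map_int_plane:
  assumes X: "simplicial_complex X"
  shows "sc_map (sc_prod int_line int_line) X A \<longleftrightarrow>
    (\<forall>i j. {A (i, j), A (i + 1, j), A (i, j + 1), A (i + 1, j + 1)} \<in> linked X)"
    (is "_ \<longleftrightarrow> (\<forall>i j. ?sq i j \<in> _)")
proof
  assume A: "sc_map (sc_prod int_line int_line) X A"
  show "\<forall>i j. ?sq i j \<in> linked X"
  proof (intro allI)
    fix i j :: int
    let ?S = "{(i, j), (i + 1, j), (i, j + 1), (i + 1, j + 1)}"
    have "fst ` ?S \<in> linked int_line" "snd ` ?S \<in> linked int_line"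
      unfolding int_line_linked by (intro exI[of _ i], simp) (intro exI[of _ j], simp)
    then have "?S \<in> linked (sc_prod int_line int_line)"
      by (simp add: sc_prod_def points_int_line)
    with A have "A ` ?S \<in> linked X" unfolding sc_map_def by blast
    then show "?sq i j \<in> linked X" by simp
  qed
next
  assume *: "\<forall>i j. ?sq i j \<in> linked X"
  have "A ` S \<in> linked X" if "S \<in> linked (sc_prod int_line int_line)" for S
  proof -
    from that have "fst ` S \<in> linked int_line" "snd ` S \<in> linked int_line"
      by (auto simp: sc_prod_def)
    then obtain i j where ij: "fst ` S \<subseteq> {i, i + 1}" "snd ` S \<subseteq> {j, j + 1}"
      unfolding int_line_linked by auto
    have "A ` S \<subseteq> ?sq i j"
    proof
      fix y assume "y \<in> A ` S"
      then obtain p q where "(p, q) \<in> S" "y = A (p, q)" by auto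
      moreover from this have "p \<in> {i, i + 1}" "q \<in> {j, j + 1}" using ij by force+
      ultimately show "y \<in> ?sq i j" by auto
    qed
    with X * show ?thesis using linked_subset by metis
  qed
  moreover have "A p \<in> points X" for p
    using linked_points[OF X *[rule_format, of "fst p" "snd p"], of "A p"] by simp
  ultimately show "sc_map (sc_prod int_line int_line) X A" unfolding sc_map_def by simp
qed

section \<open>Supports and end points of paths\<close>

lemma path_supportD:
  assumes "path_support a m n"
  shows "m \<le> n" "i \<le> m \<Longrightarrow> a i = a m" "n \<le> i \<Longrightarrow> a i = a n"
  using assms unfolding path_support_def by blast+

lemma path_support_mono:
  assumes s: "path_support a m n" and "m' \<le> m" "n \<le> n'"
  shows "path_support a m' n'"
  unfolding path_support_def
proof (intro conjI allI impI)
  show "m' \<le> n'" using path_supportD(1)[OF s] assms(2,3) by linarith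
  show "a i = a m'" if "i \<le> m'" for i
    using path_supportD(2)[OF s, of i] path_supportD(2)[OF s, of m'] that assms(2) by simp
  show "a i = a n'" if "n' \<le> i" for i
    using path_supportD(3)[OF s, of i] path_supportD(3)[OF s, of n'] that assms(3) by simp
qed

lemma path_support_ends_eq:
  assumes s: "path_support a m n" and s': "path_support a m' n'"
  shows "a m = a m'" "a n = a n'"
  using path_supportD(2)[OF s, of m'] path_supportD(2)[OF s', of m]
    path_supportD(3)[OF s, of n'] path_supportD(3)[OF s', of n]
  by (metis linear)+

text \<open>For a nonconstant path the supports are exactly the pairs in \<open>L\<close> times
  \<open>M\<close>, where \<open>L\<close> holds the possible left ends and \<open>M\<close> the
  possible right ends. The least support is therefore formed by the maximum of \<open>L\<close> and
  the minimum of \<open>M\<close>.\<close>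

lemma path_support_std:
  assumes "path_support a m n"
  shows "path_support a (rho_minus a) (rho_plus a)"
proof (cases "\<exists>x. \<forall>i. a i = x")
  case True
  then show ?thesis by (auto simp: rho_minus_def rho_plus_def std_support_def path_support_def)
next
  case False
  define x where "x = a m"
  define y where "y = a n"
  define L where "L = {k. \<forall>i\<le>k. a i = x}"
  define M where "M = {k. \<forall>i\<ge>k. a i = y}"
  have m: "m \<in> L" and n: "n \<in> M"
    using path_supportD[OF assms] unfolding L_def M_def x_def y_def by blast+
  \<comment> \<open>If the two constant tails met, they would share a value and cover the line,
    making the path constant.\<close>
  have LM: "k < l" if "k \<in> L" "l \<in> M" for k l
  proof (rule ccontr)
    assume "\<not> k < l"
    then have lk: "l \<le> k" by simp
    then have "x = y" using that unfolding L_def M_def by auto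
    moreover have "a i = x \<or> a i = y" for i
      using that lk unfolding L_def M_def by (cases "i \<le> k") auto
    ultimately show False using False by metis
  qed
  \<comment> \<open>\<open>L\<close> is bounded above by \<open>n\<close>, so its maximum is found
    by minimizing the distance to \<open>n\<close>, a natural number. Dually, \<open>q\<close>
    minimizes the distance from \<open>m\<close>.\<close>
  define p where "p = n - int (LEAST k. n - int k \<in> L)"
  have ex: "n - int (nat (n - m)) \<in> L" using m path_supportD(1)[OF assms] by simp
  have p: "p \<in> L" unfolding p_def by (rule LeastI[of "\<lambda>k. n - int k \<in> L", OF ex])
  have p_max: "k \<le> p" if "k \<in> L" for k
  proof -
    have "n - int (nat (n - k)) \<in> L" using that LM[OF that n] by simp
    then have "(LEAST k. n - int k \<in> L) \<le> nat (n - k)" by (rule Least_le)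
    then show ?thesis using LM[OF that n] unfolding p_def by linarith
  qed
  define q where "q = m + int (LEAST k. m + int k \<in> M)"
  have ex: "m + int (nat (n - m)) \<in> M" using n path_supportD(1)[OF assms] by simp
  have q: "q \<in> M" unfolding q_def by (rule LeastI[of "\<lambda>k. m + int k \<in> M", OF ex])
  have q_min: "q \<le> k" if "k \<in> M" for k
  proof -
    have "m + int (nat (k - m)) \<in> M" using that LM[OF m that] by simp
    then have "(LEAST k. m + int k \<in> M) \<le> nat (k - m)" by (rule Least_le)
    then show ?thesis using LM[OF m that] unfolding q_def by linarith
  qed
  have supp: "path_support a m' n' \<longleftrightarrow> m' \<in> L \<and> n' \<in> M" for m' n'
  proof
    assume s: "path_support a m' n'"
    show "m' \<in> L \<and> n' \<in> M"
      using path_support_ends_eq[OF s assms] path_supportD(2,3)[OF s]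
      unfolding L_def M_def x_def y_def mem_Collect_eq by metis
  next
    assume *: "m' \<in> L \<and> n' \<in> M"
    then have "\<forall>i\<le>m'. a i = x" "\<forall>i\<ge>n'. a i = y" by (simp_all add: L_def M_def)
    then show "path_support a m' n'" using LM[of m' n'] * unfolding path_support_def
      by (metis less_imp_le order_refl)
  qed
  have "std_support a = (p, q)"
    unfolding std_support_def if_not_P[OF False]
  proof (rule the_equality)
    show "path_support a (fst (p, q)) (snd (p, q)) \<and>
      (\<forall>m n. path_support a m n \<longrightarrow> {fst (p, q)..snd (p, q)} \<subseteq> {m..n})"
      using p q p_max q_min by (auto simp: supp intro: order_trans)
  next
    fix r assume r: "path_support a (fst r) (snd r) \<and>
      (\<forall>m n. path_support a m n \<longrightarrow> {fst r..snd r} \<subseteq> {m..n})"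
    then have "fst r \<le> snd r" using path_supportD(1) by blast
    moreover have "{fst r..snd r} \<subseteq> {p..q}" using r p q by (simp add: supp)
    ultimately have "p \<le> fst r" "snd r \<le> q" by simp_all
    moreover have "fst r \<le> p" "q \<le> snd r" using r p_max q_min by (simp_all add: supp)
    ultimately show "r = (p, q)" by (simp add: prod_eq_iff)
  qed
  then show ?thesis using p q by (simp add: rho_minus_def rho_plus_def supp)
qed

text \<open>Any two supports give the same end values, so a convenient support may replace the
  standard one.\<close>

lemma path_start_support: "path_support a m n \<Longrightarrow> path_start a = a m"
  and path_end_support: "path_support a m n \<Longrightarrow> path_end a = a n"
  unfolding path_start_def path_end_def
  using path_support_std path_support_ends_eq by metis+

lemma sc_pathI:
  assumes "simplicial_complex X" "\<And>i. {a i, a (i + 1)} \<in> linked X" "path_support a m n"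
  shows "sc_path X a"
  using assms sc_map_int_line[OF assms(1)] unfolding sc_path_def by blast

lemma sc_path_support: "sc_path X a \<Longrightarrow> path_support a (rho_minus a) (rho_plus a)"
  using path_support_std unfolding sc_path_def by blast

lemma sc_path_step:
  assumes "simplicial_complex X" "sc_path X a"
  shows "{a i, a (i + 1)} \<in> linked X"
  using assms sc_map_int_line[OF assms(1)] unfolding sc_path_def by blast

text \<open>Off the interval \<open>[0, length w - 1]\<close> the function stays at the end points of \<open>w\<close>.\<close>

definition path_of :: "'a list \<Rightarrow> int \<Rightarrow> 'a" where
  "path_of w i = w ! min (nat i) (length w - 1)"

lemma path_of_left: "w \<noteq> [] \<Longrightarrow> i \<le> 0 \<Longrightarrow> path_of w i = hd w"
  by (simp add: path_of_def hd_conv_nth)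

lemma path_of_right: "w \<noteq> [] \<Longrightarrow> int (length w) - 1 \<le> i \<Longrightarrow> path_of w i = last w"
  by (simp add: path_of_def last_conv_nth min_absorb2)

lemma path_support_path_of:
  assumes "w \<noteq> []"
  shows "path_support (path_of w) 0 (int (length w) - 1)"
proof -
  have "0 \<le> int (length w) - 1" using assms by (cases w) auto
  then show ?thesis using assms by (simp add: path_support_def path_of_left path_of_right)
qed

lemma sc_path_path_of:
  assumes X: "simplicial_complex X" and w: "walk X w"
  shows "sc_path X (path_of w)"
proof (rule sc_pathI[OF X _ path_support_path_of[OF walk_ne[OF w]]])
  fix i
  have nth: "w ! k \<in> points X" if "k < length w" for k
    using w that nth_mem unfolding walk_def by blast
  have ne: "length w > 0" using walk_ne[OF w] by simp
  show "{path_of w i, path_of w (i + 1)} \<in> linked X"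
  proof (cases "0 \<le> i \<and> i < int (length w) - 1")
    case True
    then have *: "Suc (nat i) < length w" "min (nat i) (length w - 1) = nat i"
      "min (nat (i + 1)) (length w - 1) = Suc (nat i)" by linarith+
    have "{w ! nat i, w ! Suc (nat i)} \<in> linked X"
      using w * successively_conv_nth unfolding walk_def by metis
    then show ?thesis using * by (simp add: path_of_def)
  next
    case False
    then have "path_of w (i + 1) = path_of w i"
      unfolding path_of_def by (intro arg_cong[where f = "(!) w"]) linarith
    moreover have "path_of w i \<in> points X" unfolding path_of_def by (rule nth) (use ne in linarith)
    ultimately show ?thesis using linked_single[OF X] by simp
  qed
qed

lemma path_start_path_of: "w \<noteq> [] \<Longrightarrow> path_start (path_of w) = hd w"
  using path_start_support[OF path_support_path_of, of w] by (simp add: path_of_left)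

lemma path_end_path_of: "w \<noteq> [] \<Longrightarrow> path_end (path_of w) = last w"
  using path_end_support[OF path_support_path_of, of w] by (simp add: path_of_right)

lemma walk_word:
  assumes X: "simplicial_complex X" and a: "sc_path X a" and "m \<le> n"
  shows "walk X (map a [m..n])"
  using assms(3)
proof (induction n rule: int_ge_induct)
  case base
  then show ?case using linked_points[OF X sc_path_step[OF X a, of m]] by (simp add: walk_single)
next
  case (step n)
  have "walk X (map a [m..n] @ tl [a n, a (n + 1)])"
    using step.IH step.hyps sc_path_step[OF X a, of n]
    by (intro walk_glue) (simp_all add: walk_pair[OF X] upto_rec2 last_map)
  then show ?case using step.hyps upto_rec2[of m "n + 1"] by simp
qed

section \<open>Homotopy of paths and equivalence of walks\<close>

lemma path_ends:
  assumes "sc_path X a"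
  shows "\<exists>m n. m \<le> n \<and> (\<forall>i\<le>m. a i = path_start a) \<and> (\<forall>i\<ge>n. a i = path_end a)"
  using sc_path_support[OF assms] unfolding path_start_def path_end_def path_support_def by blast

lemma path_by_ends:
  assumes X: "simplicial_complex X" and steps: "\<And>i. {a i, a (i + 1)} \<in> linked X"
    and "m \<le> n" "\<And>i. i \<le> m \<Longrightarrow> a i = x" "\<And>i. n \<le> i \<Longrightarrow> a i = y"
  shows "sc_path X a" "path_start a = x" "path_end a = y"
proof -
  have s: "path_support a m n" unfolding path_support_def using assms(3-) by simp
  show "sc_path X a" by (rule sc_pathI[OF X steps s])
  show "path_start a = x" "path_end a = y"
    using path_start_support[OF s] path_end_support[OF s] assms(4,5) by simp_all
qed

lemma homotopy2D:
  assumes "(a, b) \<in> homotopy2 X"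
  shows "sc_path X a" "sc_path X b" "path_start a = path_start b" "path_end a = path_end b"
  using assms by (simp_all add: homotopy2_def)

lemma homotopy2I:
  fixes A :: "int \<Rightarrow> int \<Rightarrow> 'a"
  assumes "simplicial_complex X" "sc_path X a" "sc_path X b"
    and "path_start b = path_start a" "path_end b = path_end a"
    and "\<And>i j. {A i j, A (i + 1) j, A i (j + 1), A (i + 1) (j + 1)} \<in> linked X"
    and "r \<le> s" "u \<le> v"
    and "\<And>i j. i \<le> r \<Longrightarrow> A i j = path_start a" "\<And>i j. s \<le> i \<Longrightarrow> A i j = path_end a"
    and "\<And>i j. j \<le> u \<Longrightarrow> A i j = a i" "\<And>i j. v \<le> j \<Longrightarrow> A i j = b i"
  shows "(a, b) \<in> homotopy2 X"
proof -
  have A: "sc_map (sc_prod int_line int_line) X (case_prod A)"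
    using assms(6) by (simp add: sc_map_int_plane[OF assms(1)])
  show ?thesis
    unfolding homotopy2_def mem_Collect_eq case_prod_conv
    by (intro conjI exI[of _ "case_prod A"] exI[of _ r] exI[of _ s] exI[of _ u] exI[of _ v] allI impI)
      (use A assms in simp_all)
qed

lemma homotopy2E:
  assumes "simplicial_complex X" "(a, b) \<in> homotopy2 X"
  obtains A :: "int \<Rightarrow> int \<Rightarrow> 'a" and r s u v where
    "\<And>i j. {A i j, A (i + 1) j, A i (j + 1), A (i + 1) (j + 1)} \<in> linked X"
    "r \<le> s" "u \<le> v"
    "\<And>i j. i \<le> r \<Longrightarrow> A i j = path_start a" "\<And>i j. s \<le> i \<Longrightarrow> A i j = path_end a"
    "\<And>i j. j \<le> u \<Longrightarrow> A i j = a i" "\<And>i j. v \<le> j \<Longrightarrow> A i j = b i"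
proof -
  from assms(2) obtain A :: "int \<times> int \<Rightarrow> 'a" and r s u v where
    A: "sc_map (sc_prod int_line int_line) X A" "r \<le> s" "u \<le> v"
      "\<forall>i j. i \<le> r \<longrightarrow> A (i, j) = path_start a" "\<forall>i j. i \<ge> s \<longrightarrow> A (i, j) = path_end a"
      "\<forall>i j. j \<le> u \<longrightarrow> A (i, j) = a i" "\<forall>i j. j \<ge> v \<longrightarrow> A (i, j) = b i"
    unfolding homotopy2_def by blast
  show thesis
    by (rule that[of "curry A" r s u v]) (use A sc_map_int_plane[OF assms(1), of A] in simp_all)
qed

lemma homotopy2_refl:
  assumes X: "simplicial_complex X" and a: "sc_path X a"
  shows "(a, a) \<in> homotopy2 X"
proof -
  obtain m n where mn: "m \<le> n" "\<And>i. i \<le> m \<Longrightarrow> a i = path_start a" "\<And>i. n \<le> i \<Longrightarrow> a i = path_end a"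
    using path_ends[OF a] by blast
  show ?thesis
    by (rule homotopy2I[OF X a a, where A = "\<lambda>i _. a i" and u = 0 and v = 0, OF _ _ _ mn(1)])
      (use mn sc_path_step[OF X a] in \<open>simp_all add: insert_commute\<close>)
qed

lemma homotopy2_sym:
  assumes X: "simplicial_complex X" and "(a, b) \<in> homotopy2 X"
  shows "(b, a) \<in> homotopy2 X"
  using assms
proof (rule homotopy2E)
  fix A :: "int \<Rightarrow> int \<Rightarrow> 'a" and r s u v
  assume sq: "\<And>i j. {A i j, A (i + 1) j, A i (j + 1), A (i + 1) (j + 1)} \<in> linked X"
    and A: "r \<le> s" "u \<le> v"
      "\<And>i j. i \<le> r \<Longrightarrow> A i j = path_start a" "\<And>i j. s \<le> i \<Longrightarrow> A i j = path_end a"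
      "\<And>i j. j \<le> u \<Longrightarrow> A i j = a i" "\<And>i j. v \<le> j \<Longrightarrow> A i j = b i"
  show ?thesis
  proof (rule homotopy2I[OF X, where A = "\<lambda>i j. A i (- j)" and r = r and s = s and u = "- v" and v = "- u"])
    fix i j
    have "{A i (- j - 1), A (i + 1) (- j - 1), A i (- j), A (i + 1) (- j)} \<in> linked X"
      using sq[of i "- j - 1"] by simp
    then show "{A i (- j), A (i + 1) (- j), A i (- (j + 1)), A (i + 1) (- (j + 1))} \<in> linked X"
      by (rule linked_subset[OF X]) auto
  qed (use A homotopy2D[OF assms(2)] in simp_all)
qed

lemma homotopy2_trans:
  assumes X: "simplicial_complex X" and ab: "(a, b) \<in> homotopy2 X" and bc: "(b, c) \<in> homotopy2 X"
  shows "(a, c) \<in> homotopy2 X"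
  using X ab
proof (rule homotopy2E)
  fix A :: "int \<Rightarrow> int \<Rightarrow> 'a" and r s u v
  assume sqA: "\<And>i j. {A i j, A (i + 1) j, A i (j + 1), A (i + 1) (j + 1)} \<in> linked X"
    and A: "r \<le> s" "u \<le> v"
      "\<And>i j. i \<le> r \<Longrightarrow> A i j = path_start a" "\<And>i j. s \<le> i \<Longrightarrow> A i j = path_end a"
      "\<And>i j. j \<le> u \<Longrightarrow> A i j = a i" "\<And>i j. v \<le> j \<Longrightarrow> A i j = b i"
  from X bc show ?thesis
  proof (rule homotopy2E)
    fix B :: "int \<Rightarrow> int \<Rightarrow> 'a" and r' s' u' v'
    assume sqB: "\<And>i j. {B i j, B (i + 1) j, B i (j + 1), B (i + 1) (j + 1)} \<in> linked X"
      and B: "r' \<le> s'" "u' \<le> v'"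
        "\<And>i j. i \<le> r' \<Longrightarrow> B i j = path_start b" "\<And>i j. s' \<le> i \<Longrightarrow> B i j = path_end b"
        "\<And>i j. j \<le> u' \<Longrightarrow> B i j = b i" "\<And>i j. v' \<le> j \<Longrightarrow> B i j = c i"
    \<comment> \<open>\<open>B\<close> is translated so that its row \<open>u'\<close> lands on row
      \<open>v\<close> of \<open>A\<close>. Both rows equal \<open>b\<close>, so the two formulas
      agree along the seam.\<close>
    define C where "C i j = (if j \<le> v then A i j else B i (j - v + u'))" for i j
    show ?thesis
    proof (rule homotopy2I[OF X, where A = C and r = "min r r'" and s = "max s s'"
          and u = u and v = "v + (v' - u')"])
      fix i j
      have B_C: "C i j = B i (j - v + u')" if "v \<le> j" for i j
        using that A(6)[of v i] B(5)[of u' i] by (cases "j = v") (simp_all add: C_def)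
      show "{C i j, C (i + 1) j, C i (j + 1), C (i + 1) (j + 1)} \<in> linked X"
      proof (cases "j < v")
        case True
        then show ?thesis using sqA[of i j] by (simp add: C_def)
      next
        case False
        then show ?thesis using sqB[of i "j - v + u'"] by (simp add: B_C algebra_simps)
      qed
      show "C i j = c i" if "v + (v' - u') \<le> j"
        using that B_C[of j i] B(2) B(6)[of "j - v + u'" i] by simp
    qed (use A B homotopy2D[OF ab] homotopy2D[OF bc] in \<open>simp_all add: C_def\<close>)
  qed
qed

text \<open>Rows up to 0 are \<open>a\<close> and rows from 1 on are \<open>b\<close>, so only one
  strip of squares depends on both paths, and the hypothesis \<open>sq\<close> says that these
  squares are linked.\<close>

lemma homotopy2_contiguous:
  assumes X: "simplicial_complex X" and a: "sc_path X a" and b: "sc_path X b"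
    and ends: "path_start b = path_start a" "path_end b = path_end a"
    and sq: "\<And>i. {a i, a (i + 1), b i, b (i + 1)} \<in> linked X"
  shows "(a, b) \<in> homotopy2 X"
proof -
  obtain m n where mn: "m \<le> n" "\<And>i. i \<le> m \<Longrightarrow> a i = path_start a" "\<And>i. n \<le> i \<Longrightarrow> a i = path_end a"
    using path_ends[OF a] by blast
  obtain m' n' where mn': "m' \<le> n'" "\<And>i. i \<le> m' \<Longrightarrow> b i = path_start a" "\<And>i. n' \<le> i \<Longrightarrow> b i = path_end a"
    using path_ends[OF b] unfolding ends by blast
  define A where "A i j = (if j \<le> 0 then a i else b i)" for i j :: int
  show ?thesis
  proof (rule homotopy2I[OF X a b ends, where A = A and r = "min m m'" and s = "max n n'"
        and u = 0 and v = 1])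
    fix i j :: int
    consider "j < 0" | "j = 0" | "0 < j" by linarith
    then show "{A i j, A (i + 1) j, A i (j + 1), A (i + 1) (j + 1)} \<in> linked X"
      using sq[of i] sc_path_step[OF X a, of i] sc_path_step[OF X b, of i]
      by cases (simp_all add: A_def insert_commute)
  qed (use mn mn' in \<open>simp_all add: A_def\<close>)
qed

subsection \<open>Delays and translations\<close>

text \<open>The value at \<open>k\<close> is held for one extra unit of time. This is the
  counterpart for paths of the move \<open>dup\<close>.\<close>

definition delay :: "int \<Rightarrow> (int \<Rightarrow> 'a) \<Rightarrow> int \<Rightarrow> 'a" where
  "delay k a i = (if i \<le> k then a i else a (i - 1))"

lemma delay_path:
  assumes X: "simplicial_complex X" and a: "sc_path X a"
  shows "sc_path X (delay k a)" "path_start (delay k a) = path_start a" "path_end (delay k a) = path_end a"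
proof -
  obtain m n where mn: "m \<le> n" "\<And>i. i \<le> m \<Longrightarrow> a i = path_start a" "\<And>i. n \<le> i \<Longrightarrow> a i = path_end a"
    using path_ends[OF a] by blast
  have "{delay k a i, delay k a (i + 1)} \<in> linked X" for i
  proof -
    have "{a k} \<in> linked X" using sc_path_step[OF X a, of k] by (rule linked_subset[OF X]) simp
    then show ?thesis using sc_path_step[OF X a, of i] sc_path_step[OF X a, of "i - 1"]
      by (cases "i = k") (auto simp: delay_def)
  qed
  moreover have "delay k a i = path_start a" if "i \<le> min m k" for i
    using mn that by (simp add: delay_def)
  moreover have "delay k a i = path_end a" if "max n k + 1 \<le> i" for i
  proof -
    have "\<not> i \<le> k" "n \<le> i - 1" using that by linarith+
    then show ?thesis using mn(3) by (simp add: delay_def)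
  qed
  moreover have "min m k \<le> max n k + 1" using mn(1) by linarith
  ultimately show "sc_path X (delay k a)" "path_start (delay k a) = path_start a"
    "path_end (delay k a) = path_end a"
    using path_by_ends[OF X, of "delay k a" "min m k" "max n k + 1"] by blast+
qed

text \<open>A delay placed in the right constant tail changes nothing. It is moved left one unit at
  a time, and each such step changes the path at one argument only.\<close>

lemma homotopy2_delay:
  assumes X: "simplicial_complex X" and a: "sc_path X a"
  shows "(a, delay k a) \<in> homotopy2 X"
proof -
  obtain m n where mn: "m \<le> n" "\<And>i. i \<le> m \<Longrightarrow> a i = path_start a" "\<And>i. n \<le> i \<Longrightarrow> a i = path_end a"
    using path_ends[OF a] by blast
  have big: "delay k a = a" if "n \<le> k" for k
    using mn(3) that by (intro ext) (simp add: delay_def)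
  show ?thesis
  proof (cases "n \<le> k")
    case True
    then show ?thesis using big homotopy2_refl[OF X a] by simp
  next
    case False
    then have "k \<le> n" by simp
    then show ?thesis
    proof (induction k rule: int_le_induct)
      case base
      then show ?case using big homotopy2_refl[OF X a] by simp
    next
      case (step k)
      \<comment> \<open>All four values lie on a single edge of \<open>a\<close>: the one starting
        at \<open>i\<close> if \<open>i < k\<close>, and the one starting at \<open>i - 1\<close>
        otherwise.\<close>
      have "{delay k a i, delay k a (i + 1), delay (k - 1) a i, delay (k - 1) a (i + 1)} \<in> linked X" for i
      proof (cases "i < k")
        case True
        then show ?thesis
          by (intro linked_subset[OF X sc_path_step[OF X a, of i]]) (auto simp: delay_def)
      next
        case False
        then show ?thesis
          by (intro linked_subset[OF X sc_path_step[OF X a, of "i - 1"]]) (auto simp: delay_def)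
      qed
      then have "(delay k a, delay (k - 1) a) \<in> homotopy2 X"
        by (intro homotopy2_contiguous[OF X]) (simp_all add: delay_path[OF X a])
      with step.IH show ?case by (rule homotopy2_trans[OF X])
    qed
  qed
qed

text \<open>A delay placed in the left constant tail is the translation by one to the right.
  Translations to the left follow by symmetry of homotopy.\<close>

lemma homotopy2_shift:
  assumes X: "simplicial_complex X" and a: "sc_path X a"
  shows "(a, \<lambda>i. a (i + k)) \<in> homotopy2 X"
proof -
  have right_shift: "(a, \<lambda>i. a (i - int n)) \<in> homotopy2 X" if "sc_path X a" for a n
  proof (induction n)
    case 0
    then show ?case using homotopy2_refl[OF X that] by simp
  next
    case (Suc n)
    define b where "b = (\<lambda>i. a (i - int n))"
    have b: "sc_path X b" using homotopy2D(2)[OF Suc] by (simp add: b_def)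
    obtain m n' where mn: "m \<le> n'" "\<And>i. i \<le> m \<Longrightarrow> b i = path_start b" "\<And>i. n' \<le> i \<Longrightarrow> b i = path_end b"
      using path_ends[OF b] by blast
    have "delay m b = (\<lambda>i. b (i - 1))"
      using mn(2) by (intro ext) (simp add: delay_def)
    then have "(b, \<lambda>i. b (i - 1)) \<in> homotopy2 X"
      using homotopy2_delay[OF X b, of m] by simp
    moreover have "(\<lambda>i. b (i - 1)) = (\<lambda>i. a (i - int (Suc n)))"
      by (simp add: b_def algebra_simps)
    ultimately show ?case using homotopy2_trans[OF X Suc] by (simp add: b_def)
  qed
  show ?thesis
  proof (cases "k \<le> 0")
    case True
    then show ?thesis using right_shift[OF a, of "nat (- k)"] by simp
  next
    case False
    define b where "b = (\<lambda>i. a (i + k))"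
    obtain m n where mn: "m \<le> n" "\<And>i. i \<le> m \<Longrightarrow> a i = path_start a" "\<And>i. n \<le> i \<Longrightarrow> a i = path_end a"
      using path_ends[OF a] by blast
    have "{b i, b (i + 1)} \<in> linked X" for i
      using sc_path_step[OF X a, of "i + k"] by (simp add: b_def algebra_simps)
    then have "sc_path X b"
      by (rule path_by_ends(1)[OF X, of b "m - k" "n - k" "path_start a" "path_end a"])
        (use mn in \<open>simp_all add: b_def\<close>)
    from right_shift[OF this, of "nat k"] have "(b, a) \<in> homotopy2 X" using False by (simp add: b_def)
    then show ?thesis using homotopy2_sym[OF X] by (simp add: b_def)
  qed
qed

section \<open>From words to homotopies\<close>

lemma path_of_word:
  assumes s: "path_support a m n"
  shows "path_of (map a [m..n]) = (\<lambda>i. a (i + m))"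
proof
  fix i
  let ?w = "map a [m..n]"
  have mn: "m \<le> n" and ne: "?w \<noteq> []" using path_supportD(1)[OF s] by simp_all
  consider "i \<le> 0" | "n - m \<le> i" | "0 \<le> i" "i \<le> n - m" by linarith
  then show "path_of ?w i = a (i + m)"
  proof cases
    case 1
    then show ?thesis using path_of_left[OF ne] path_supportD(2)[OF s, of "i + m"] mn
      by (simp add: upto_rec1)
  next
    case 2
    then show ?thesis using path_of_right[OF ne, of i] path_supportD(3)[OF s, of "i + m"] mn
      by (simp add: last_map upto_rec2)
  next
    case 3
    then have "min (nat i) (length ?w - 1) = nat i" "nat i < length [m..n]" by auto
    then show ?thesis using 3 by (simp add: path_of_def add.commute)
  qed
qed

lemma homotopy2_word:
  assumes "simplicial_complex X" "sc_path X a" "path_support a m n"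
  shows "(a, path_of (map a [m..n])) \<in> homotopy2 X"
  using homotopy2_shift[OF assms(1,2)] path_of_word[OF assms(3)] by simp

lemma walk_nth_linked:
  assumes "walk X w" "Suc i < length w"
  shows "{w ! i, w ! Suc i} \<in> linked X"
  using assms successively_nth unfolding walk_def by metis

lemma path_of_nth:
  assumes "0 \<le> i" "i < int (length w)"
  shows "path_of w i = w ! nat i"
proof -
  have "min (nat i) (length w - 1) = nat i" using assms by linarith
  then show ?thesis by (simp add: path_of_def)
qed

lemma homotopy2_ladder:
  assumes X: "simplicial_complex X" and u: "walk X u" and v: "walk X v"
    and len: "length v = length u" and ends: "hd v = hd u" "last v = last u"
    and sq: "\<And>i. Suc i < length u \<Longrightarrow> {u ! i, u ! Suc i, v ! i, v ! Suc i} \<in> linked X"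
  shows "(path_of u, path_of v) \<in> homotopy2 X"
proof (rule homotopy2_contiguous[OF X sc_path_path_of[OF X u] sc_path_path_of[OF X v]])
  note ne = walk_ne[OF u] walk_ne[OF v]
  show "path_start (path_of v) = path_start (path_of u)" "path_end (path_of v) = path_end (path_of u)"
    using ends ne by (simp_all add: path_start_path_of path_end_path_of)
  fix i
  consider "i + 1 \<le> 0" | "int (length u) - 1 \<le> i" | "0 \<le> i" "i + 1 < int (length u)" by linarith
  then show "{path_of u i, path_of u (i + 1), path_of v i, path_of v (i + 1)} \<in> linked X"
  proof cases
    case 1
    then show ?thesis using ne ends linked_single[OF X walk_ends(1)[OF u]] by (simp add: path_of_left)
  next
    case 2
    then show ?thesis using ne ends len linked_single[OF X walk_ends(2)[OF u]] by (simp add: path_of_right)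
  next
    case 3
    then have "nat (i + 1) = Suc (nat i)" "Suc (nat i) < length u" by linarith+
    then show ?thesis using sq[of "nat i"] 3 len by (simp add: path_of_nth)
  qed
qed

text \<open>The position \<open>length xs\<close> is that of the first copy of \<open>x\<close>,
  which is the value being held.\<close>

lemma path_of_dup: "path_of (xs @ x # x # ys) = delay (int (length xs)) (path_of (xs @ x # ys))"
proof
  fix i
  let ?p = "xs @ x # ys" and ?q = "xs @ x # x # ys"
  have nth: "?q ! j = (if j \<le> length xs then ?p ! j else ?p ! (j - 1))" for j
    by (auto simp: nth_append nth_Cons' not_le)
  show "path_of ?q i = delay (int (length xs)) (path_of ?p) i"
  proof (cases "i \<le> int (length xs)")
    case True
    then have "min (nat i) (length ?q - 1) = nat i" "min (nat i) (length ?p - 1) = nat i"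
      by (simp_all add: min_absorb1)
    then show ?thesis using True nth by (simp add: path_of_def delay_def)
  next
    case False
    define j where "j = min (nat i) (length ?q - 1)"
    have "min (nat (i - 1)) (length ?p - 1) = j - 1" "\<not> j \<le> length xs"
      using False by (auto simp: j_def min_def)
    then show ?thesis using False nth[of j] unfolding path_of_def delay_def j_def[symmetric] by simp
  qed
qed

lemma move_homotopic:
  assumes X: "simplicial_complex X" and u: "walk X u" and "move X u v"
  shows "(path_of u, path_of v) \<in> homotopy2 X"
  using assms(3)
proof cases
  case (dup xs x ys)
  then show ?thesis using homotopy2_delay[OF X sc_path_path_of[OF X u]] by (simp add: path_of_dup)
next
  case (tri x y z xs ys)
  \<comment> \<open>\<open>tri\<close> lengthens the word, so \<open>u\<close> is first padded by
    repeating \<open>z\<close>. The words \<open>?v'\<close> and \<open>v\<close> then have equal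
    length and differ in one letter, and the two squares touching that letter are faces of the given
    triple.\<close>
  let ?v' = "xs @ x # z # z # ys"
  have v: "walk X v" using move_walk[OF X assms(3)] u by simp
  have v': "walk X ?v'"
    using move_walk[OF X move.dup[of X "xs @ [x]" z ys]] u tri(1) by simp
  have "(path_of u, path_of ?v') \<in> homotopy2 X"
    using homotopy2_delay[OF X sc_path_path_of[OF X u]] path_of_dup[of "xs @ [x]" z ys] tri(1) by simp
  moreover have "(path_of ?v', path_of v) \<in> homotopy2 X"
  proof (rule homotopy2_ladder[OF X v' v])
    show "length v = length ?v'" "hd v = hd ?v'" "last v = last ?v'"
      using tri(2) by (simp_all add: hd_append)
    fix i assume i: "Suc i < length ?v'"
    consider "i < length xs" | "i = length xs" | "i = Suc (length xs)" | "Suc (length xs) < i" by linarith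
    then show "{?v' ! i, ?v' ! Suc i, v ! i, v ! Suc i} \<in> linked X"
    proof cases
      case 1
      then have "v ! i = ?v' ! i" "v ! Suc i = ?v' ! Suc i"
        using tri(2) by (auto simp: nth_append nth_Cons')
      then show ?thesis using walk_nth_linked[OF v' i] by (simp add: insert_commute)
    next
      case 2
      then have "?v' ! i = x" "?v' ! Suc i = z" "v ! i = x" "v ! Suc i = y"
        using tri(2) by (simp_all add: nth_append)
      then show ?thesis using tri(3) by (simp add: insert_commute)
    next
      case 3
      then have "?v' ! i = z" "?v' ! Suc i = z" "v ! i = y" "v ! Suc i = z"
        using tri(2) by (simp_all add: nth_append)
      then show ?thesis using linked_subset[OF X tri(3), of "{z, y}"] by (simp add: insert_commute)
    next
      case 4
      then have "v ! i = ?v' ! i" "v ! Suc i = ?v' ! Suc i"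
        using tri(2) by (auto simp: nth_append nth_Cons')
      then show ?thesis using walk_nth_linked[OF v' i] by (simp add: insert_commute)
    qed
  qed
  ultimately show ?thesis by (rule homotopy2_trans[OF X])
qed

lemma weq_homotopic:
  assumes X: "simplicial_complex X" and "weq X u v" and u: "walk X u"
  shows "(path_of u, path_of v) \<in> homotopy2 X"
  using assms(2)
proof induction
  case base
  then show ?case by (rule homotopy2_refl[OF X sc_path_path_of[OF X u]])
next
  case (step y z)
  have "walk X y" using weq_walk[OF X step(1)] u by simp
  moreover have "walk X z" using step(2) move_walk[OF X] \<open>walk X y\<close> by blast
  ultimately have "(path_of y, path_of z) \<in> homotopy2 X"
    using step(2) move_homotopic[OF X] homotopy2_sym[OF X] by blast
  with step(3) show ?case by (rule homotopy2_trans[OF X])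
qed

section \<open>From homotopies to moves on words\<close>

lemma weq_support_extend_right:
  assumes s: "path_support a m n"
  shows "weq X (map a [m..n + int k]) (map a [m..n])"
proof (induction k)
  case (Suc k)
  have mn: "m \<le> n" using path_supportD(1)[OF s] .
  have "[m..n + int (Suc k)] = [m..n + int k] @ [n + int k + 1]"
    using upto_rec2[of m "n + int k + 1"] mn by (simp add: algebra_simps)
  moreover have "[m..n + int k] = [m..n + int k - 1] @ [n + int k]"
    using upto_rec2[of m "n + int k"] mn by simp
  moreover have "a (n + int k + 1) = a (n + int k)"
    using path_supportD(3)[OF s, of "n + int k"] path_supportD(3)[OF s, of "n + int k + 1"] by simp
  ultimately have "weq X (map a [m..n + int (Suc k)]) (map a [m..n + int k])"
    using weq_dup[of X "map a [m..n + int k - 1]" "a (n + int k)" "[]"] by simp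
  then show ?case using Suc by (rule equivclp_trans)
qed simp

lemma weq_support_extend_left:
  assumes s: "path_support a m n"
  shows "weq X (map a [m - int k..n]) (map a [m..n])"
proof (induction k)
  case (Suc k)
  have mn: "m \<le> n" using path_supportD(1)[OF s] .
  have "[m - int (Suc k)..n] = (m - int k - 1) # [m - int k..n]"
    using upto_rec1[of "m - int k - 1" n] mn by (simp add: algebra_simps)
  moreover have "[m - int k..n] = (m - int k) # [m - int k + 1..n]"
    using upto_rec1[of "m - int k" n] mn by simp
  moreover have "a (m - int k - 1) = a (m - int k)"
    using path_supportD(2)[OF s, of "m - int k"] path_supportD(2)[OF s, of "m - int k - 1"] by simp
  ultimately have "weq X (map a [m - int (Suc k)..n]) (map a [m - int k..n])"
    using weq_dup[of X "[]" "a (m - int k)" "map a [m - int k + 1..n]"] by simp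
  then show ?case using Suc by (rule equivclp_trans)
qed simp

lemma weq_support:
  assumes s: "path_support a m n" and s': "path_support a m' n'"
  shows "weq X (map a [m..n]) (map a [m'..n'])"
proof -
  have *: "weq X (map a [min m m'..max n n']) (map a [p..q])"
    if p: "path_support a p q" "min m m' \<le> p" "q \<le> max n n'" for p q
  proof -
    have "path_support a p (max n n')" using path_support_mono[OF p(1)] p(3) by simp
    from weq_support_extend_left[OF this, of X "nat (p - min m m')"]
    have "weq X (map a [min m m'..max n n']) (map a [p..max n n'])" using p by simp
    moreover from weq_support_extend_right[OF p(1), of X "nat (max n n' - q)"]
    have "weq X (map a [p..max n n']) (map a [p..q])" using p by simp
    ultimately show ?thesis by (rule equivclp_trans)
  qed
  show ?thesis
    by (rule equivclp_trans[OF equivclp_sym[OF *[OF s]] *[OF s']]) simp_all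
qed

lemma weq_Cons_hd: "w \<noteq> [] \<Longrightarrow> weq X (hd w # w) w"
  using weq_dup[of X "[]"] by (cases w) simp_all

lemma weq_snoc_last: "w \<noteq> [] \<Longrightarrow> weq X (w @ [last w]) w"
  using weq_dup[of X _ _ "[]"] by (cases w rule: rev_cases) simp_all

lemma homotopic_weq:
  assumes X: "simplicial_complex X" and h: "(a, b) \<in> homotopy2 X"
    and sa: "path_support a m n" and sb: "path_support b m' n'"
  shows "weq X (map a [m..n]) (map b [m'..n'])"
  using X h
proof (rule homotopy2E)
  fix A :: "int \<Rightarrow> int \<Rightarrow> 'a" and r s u v
  assume sq: "\<And>i j. {A i j, A (i + 1) j, A i (j + 1), A (i + 1) (j + 1)} \<in> linked X"
    and A: "r \<le> s" "u \<le> v"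
      "\<And>i j. i \<le> r \<Longrightarrow> A i j = path_start a" "\<And>i j. s \<le> i \<Longrightarrow> A i j = path_end a"
      "\<And>i j. j \<le> u \<Longrightarrow> A i j = a i" "\<And>i j. v \<le> j \<Longrightarrow> A i j = b i"
  define row where "row j = map (\<lambda>i. A i j) [r..s]" for j
  have supp: "path_support (\<lambda>i. A i j) r s" for j
    using A(1,3,4) unfolding path_support_def by simp
  have row_ends: "hd (row j) = path_start a" "last (row j) = path_end a" for j
    using A(1,3,4) arg_cong[OF upto_rec1[of r s], of hd] arg_cong[OF upto_rec2[of r s], of last]
    by (simp_all add: row_def hd_map last_map)
  have "weq X (row j) (row (j + 1))" for j
  proof -
    have "weq X (hd (row j) # row (j + 1)) (row j @ [last (row (j + 1))])"
    proof (rule ladder_weq[OF X])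
      fix i assume "Suc i < length (row j)"
      then have "r + int i + 1 \<le> s" "i < length [r..s]" "Suc i < length [r..s]" by (auto simp: row_def)
      then show "{row j ! i, row j ! Suc i, row (j + 1) ! i, row (j + 1) ! Suc i} \<in> linked X"
        using sq[of "r + int i" j] by (simp add: row_def algebra_simps)
    qed (use A(1) in \<open>simp_all add: row_def\<close>)
    moreover have "weq X (hd (row j) # row (j + 1)) (row (j + 1))"
      using weq_Cons_hd[of "row (j + 1)" X] A(1) row_ends by (simp add: row_def)
    moreover have "weq X (row j @ [last (row (j + 1))]) (row j)"
      using weq_snoc_last[of "row j" X] A(1) row_ends by (simp add: row_def)
    ultimately show ?thesis by (metis equivclp_sym equivclp_trans)
  qed
  note row_step = this
  have "weq X (row u) (row v)" using A(2)
  proof (induction v rule: int_ge_induct)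
    case (step j)
    then show ?case using row_step[of j] equivclp_trans by metis
  qed simp
  moreover have "(\<lambda>i. A i u) = a" "(\<lambda>i. A i v) = b" using A(5,6) by auto
  ultimately have "weq X (map a [r..s]) (map b [r..s])" "path_support a r s" "path_support b r s"
    using supp[of u] supp[of v] by (simp_all add: row_def)
  then show ?thesis using weq_support[OF sa] weq_support[OF _ sb] by (metis equivclp_trans)
qed

section \<open>The fundamental groupoid in terms of walks\<close>

lemma word_path_of:
  assumes "w \<noteq> []"
  shows "map (path_of w) [0..int (length w) - 1] = w"
proof (rule nth_equalityI)
  fix i assume "i < length (map (path_of w) [0..int (length w) - 1])"
  then show "map (path_of w) [0..int (length w) - 1] ! i = w ! i"
    by (simp add: path_of_nth)
qed simp

lemma homotopic_iff_weq:
  assumes X: "simplicial_complex X" and a: "sc_path X a" and b: "sc_path X b"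
    and sa: "path_support a m n" and sb: "path_support b m' n'"
  shows "(a, b) \<in> homotopy2 X \<longleftrightarrow> weq X (map a [m..n]) (map b [m'..n'])"
proof
  assume "weq X (map a [m..n]) (map b [m'..n'])"
  then have "(path_of (map a [m..n]), path_of (map b [m'..n'])) \<in> homotopy2 X"
    using weq_homotopic[OF X] walk_word[OF X a path_supportD(1)[OF sa]] by blast
  then show "(a, b) \<in> homotopy2 X"
    using homotopy2_word[OF X a sa] homotopy2_word[OF X b sb] homotopy2_sym[OF X] homotopy2_trans[OF X]
    by meson
qed (rule homotopic_weq[OF X _ sa sb])

text \<open>Arrows are named by words from here on: equality of arrows becomes \<open>weq\<close>,
  and composition becomes gluing of words.\<close>

definition path_class :: "'a scomplex \<Rightarrow> 'a list \<Rightarrow> (int \<Rightarrow> 'a) set" where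
  "path_class X w = homotopy2 X `` {path_of w}"

lemma equiv_homotopy2:
  assumes X: "simplicial_complex X"
  shows "equiv {a. sc_path X a} (homotopy2 X)"
proof (rule equivI)
  show "homotopy2 X \<subseteq> {a. sc_path X a} \<times> {a. sc_path X a}" using homotopy2D by auto
  show "refl_on {a. sc_path X a} (homotopy2 X)" using homotopy2_refl[OF X] by (simp add: refl_on_def)
  show "sym (homotopy2 X)" using homotopy2_sym[OF X] by (rule symI)
  show "trans (homotopy2 X)" using homotopy2_trans[OF X] by (rule transI)
qed

lemma homotopy2_class_eq:
  assumes "simplicial_complex X" "(a, b) \<in> homotopy2 X"
  shows "homotopy2 X `` {a} = homotopy2 X `` {b}"
  using equiv_class_eq[OF equiv_homotopy2[OF assms(1)] assms(2)] .

lemma path_class_eq_iff: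
  assumes X: "simplicial_complex X" and u: "walk X u" and v: "walk X v"
  shows "path_class X u = path_class X v \<longleftrightarrow> weq X u v"
proof -
  have "path_class X u = path_class X v \<longleftrightarrow> (path_of u, path_of v) \<in> homotopy2 X"
    unfolding path_class_def using sc_path_path_of[OF X] u v
    by (intro eq_equiv_class_iff[OF equiv_homotopy2[OF X]]) simp_all
  also have "\<dots> \<longleftrightarrow> weq X u v"
    using homotopic_iff_weq[OF X sc_path_path_of[OF X u] sc_path_path_of[OF X v]
        path_support_path_of[OF walk_ne[OF u]] path_support_path_of[OF walk_ne[OF v]]]
      word_path_of[OF walk_ne[OF u]] word_path_of[OF walk_ne[OF v]] by simp
  finally show ?thesis .
qed

lemma path_class_word:
  assumes "simplicial_complex X" "sc_path X a" "path_support a m n"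
  shows "homotopy2 X `` {a} = path_class X (map a [m..n])"
  unfolding path_class_def by (rule homotopy2_class_eq[OF assms(1) homotopy2_word[OF assms]])

lemma path_of_mem_path_class:
  assumes "simplicial_complex X" "walk X w"
  shows "path_of w \<in> path_class X w"
  using homotopy2_refl[OF assms(1) sc_path_path_of[OF assms]] by (simp add: path_class_def)

lemma mem_path_class:
  assumes X: "simplicial_complex X" and w: "walk X w" and a: "a \<in> path_class X w"
  shows "sc_path X a" "path_start a = hd w" "path_end a = last w"
    and "path_support a m n \<Longrightarrow> weq X (map a [m..n]) w"
proof -
  have h: "(path_of w, a) \<in> homotopy2 X" using a by (simp add: path_class_def)
  note ne = walk_ne[OF w]
  show "sc_path X a" "path_start a = hd w" "path_end a = last w"
    using homotopy2D[OF h] path_start_path_of[OF ne] path_end_path_of[OF ne] by simp_all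
  show "weq X (map a [m..n]) w" if "path_support a m n"
    using homotopic_weq[OF X homotopy2_sym[OF X h] that path_support_path_of[OF ne]]
    by (simp add: word_path_of[OF ne])
qed

lemma map_upto_shift: "map (\<lambda>i. f (i - k)) [m + k..n + k] = map f [m..n]" for k m n :: int
  by (rule nth_equalityI) (simp_all add: nth_map)

text \<open>The two standard supports are translated by \<open>p\<close> and by \<open>n\<close>, so
  that they meet at \<open>n + p\<close>. The common end point occurs once in the resulting word,
  hence \<open>tl\<close>.\<close>

lemma path_concat_word:
  assumes X: "simplicial_complex X" and a: "sc_path X a" and b: "sc_path X b"
    and ab: "path_end a = path_start b"
  defines "m \<equiv> rho_minus a" and "n \<equiv> rho_plus a" and "p \<equiv> rho_minus b" and "q \<equiv> rho_plus b"
  shows "sc_path X (path_concat a b)"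
    and "path_support (path_concat a b) (m + p) (n + q)"
    and "map (path_concat a b) [m + p..n + q] = map a [m..n] @ tl (map b [p..q])"
proof -
  define c where "c = path_concat a b"
  have sa: "path_support a m n" and sb: "path_support b p q"
    using sc_path_support[OF a] sc_path_support[OF b] by (simp_all add: m_def n_def p_def q_def)
  note le = path_supportD(1)[OF sa] path_supportD(1)[OF sb]
  have nb: "a n = b p" using ab by (simp add: path_end_def path_start_def n_def p_def)
  have c_left: "c i = a (i - p)" if "i \<le> n + p" for i
    using that by (simp add: c_def path_concat_def n_def p_def)
  \<comment> \<open>\<open>path_concat\<close> uses \<open>a\<close> at the seam
    \<open>n + p\<close>; the equality \<open>a n = b p\<close> makes the formula with
    \<open>b\<close> valid there too.\<close>
  have c_right: "c i = b (i - n)" if "n + p \<le> i" for i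
    using that nb c_left[of i] by (cases "i = n + p") (simp_all add: c_def path_concat_def n_def p_def)
  have steps: "{c i, c (i + 1)} \<in> linked X" for i
  proof (cases "i < n + p")
    case True
    then show ?thesis using sc_path_step[OF X a, of "i - p"] c_left[of i] c_left[of "i + 1"]
      by (simp add: algebra_simps)
  next
    case False
    then show ?thesis using sc_path_step[OF X b, of "i - n"] c_right[of i] c_right[of "i + 1"]
      by (simp add: algebra_simps)
  qed
  have supp: "path_support c (m + p) (n + q)"
    unfolding path_support_def
  proof (intro conjI allI impI)
    show "m + p \<le> n + q" using le by simp
    show "c i = c (m + p)" if "i \<le> m + p" for i
      using that le path_supportD(2)[OF sa, of "i - p"] c_left[of i] c_left[of "m + p"] by simp
    show "c i = c (n + q)" if "n + q \<le> i" for i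
      using that le path_supportD(3)[OF sb, of "i - n"] c_right[of i] c_right[of "n + q"] by simp
  qed
  have "[m + p..n + q] = [m + p..n + p] @ [n + p + 1..n + q]"
    using le by (intro upto_split2) auto
  moreover have "map c [m + p..n + p] = map (\<lambda>i. a (i - p)) [m + p..n + p]"
    by (rule map_cong) (simp_all add: c_left)
  moreover have "map c [n + p + 1..n + q] = map (\<lambda>i. b (i - n)) [p + 1 + n..q + n]"
    by (rule map_cong) (simp_all add: c_right algebra_simps)
  moreover have "tl (map b [p..q]) = map b [p + 1..q]" using upto_rec1[of p q] le by simp
  ultimately have word: "map c [m + p..n + q] = map a [m..n] @ tl (map b [p..q])"
    by (simp add: map_upto_shift)
  show "sc_path X (path_concat a b)" using sc_pathI[OF X steps supp] by (simp add: c_def)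
  show "path_support (path_concat a b) (m + p) (n + q)"
    "map (path_concat a b) [m + p..n + q] = map a [m..n] @ tl (map b [p..q])"
    using supp word by (simp_all add: c_def)
qed

text \<open>Replacing representatives changes the two words by moves, and gluing respects moves.
  Hence the double union that defines \<open>Comp\<close> runs over a constant family.\<close>

lemma path_class_concat:
  assumes X: "simplicial_complex X" and u: "walk X u" and v: "walk X v" and uv: "last u = hd v"
    and a: "a \<in> path_class X u" and b: "b \<in> path_class X v"
  shows "homotopy2 X `` {path_concat a b} = path_class X (u @ tl v)"
proof -
  note a' = mem_path_class[OF X u a] and b' = mem_path_class[OF X v b]
  define w where "w = map a [rho_minus a..rho_plus a] @ tl (map b [rho_minus b..rho_plus b])"
  have ab: "path_end a = path_start b" using a' b' uv by simp
  note c = path_concat_word[OF X a'(1) b'(1) ab]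
  have "homotopy2 X `` {path_concat a b} = path_class X w"
    using path_class_word[OF X c(1,2)] c(3) by (simp add: w_def)
  moreover have "weq X w (u @ tl v)"
    unfolding w_def
  proof (rule weq_glue[OF a'(4) b'(4)])
    show sa: "path_support a (rho_minus a) (rho_plus a)" using sc_path_support[OF a'(1)] .
    show sb: "path_support b (rho_minus b) (rho_plus b)" using sc_path_support[OF b'(1)] .
    show "map a [rho_minus a..rho_plus a] \<noteq> []" "map b [rho_minus b..rho_plus b] \<noteq> []"
      using path_supportD(1)[OF sa] path_supportD(1)[OF sb] by simp_all
    show "last (map a [rho_minus a..rho_plus a]) = hd (map b [rho_minus b..rho_plus b])"
      using weq_ends[OF a'(4)[OF sa]] weq_ends[OF b'(4)[OF sb]] uv by simp
  qed
  moreover have "walk X (u @ tl v)" using walk_glue[OF u v uv] .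
  ultimately show ?thesis using path_class_eq_iff[OF X] weq_walk[OF X] by metis
qed

lemma path_of_single: "path_of [x] = (\<lambda>_. x)"
  by (simp add: path_of_def fun_eq_iff)

context
  fixes X :: "'a scomplex"
  assumes X: "simplicial_complex X"
begin

lemma fundamental_Arr: "Arr (fundamental_gpd X) = path_class X ` {w. walk X w}"
proof -
  have "{a. sc_path X a} // homotopy2 X = path_class X ` {w. walk X w}"
  proof (intro set_eqI iffI)
    fix \<alpha> assume "\<alpha> \<in> {a. sc_path X a} // homotopy2 X"
    then obtain a where a: "sc_path X a" "\<alpha> = homotopy2 X `` {a}" by (auto elim: quotientE)
    note s = sc_path_support[OF a(1)]
    show "\<alpha> \<in> path_class X ` {w. walk X w}"
      unfolding a(2) path_class_word[OF X a(1) s]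
      using walk_word[OF X a(1) path_supportD(1)[OF s]] by simp
  next
    fix \<alpha> assume "\<alpha> \<in> path_class X ` {w. walk X w}"
    then show "\<alpha> \<in> {a. sc_path X a} // homotopy2 X"
      using sc_path_path_of[OF X] by (auto simp: path_class_def intro: quotientI)
  qed
  then show ?thesis by (simp add: fundamental_gpd_def)
qed

lemma fundamental_Dom: "walk X w \<Longrightarrow> Dom (fundamental_gpd X) (path_class X w) = hd w"
proof -
  assume w: "walk X w"
  have "path_start ` path_class X w = {hd w}"
    using mem_path_class(2)[OF X w] path_of_mem_path_class[OF X w] by force
  then show ?thesis by (simp add: fundamental_gpd_def)
qed

lemma fundamental_Cod: "walk X w \<Longrightarrow> Cod (fundamental_gpd X) (path_class X w) = last w"
proof -
  assume w: "walk X w"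
  have "path_end ` path_class X w = {last w}"
    using mem_path_class(3)[OF X w] path_of_mem_path_class[OF X w] by force
  then show ?thesis by (simp add: fundamental_gpd_def)
qed

lemma fundamental_Ide: "Ide (fundamental_gpd X) x = path_class X [x]"
  by (simp add: fundamental_gpd_def path_class_def path_of_single)

lemma fundamental_Comp:
  assumes u: "walk X u" and v: "walk X v" and uv: "last u = hd v"
  shows "Comp (fundamental_gpd X) (path_class X u) (path_class X v) = path_class X (u @ tl v)"
proof -
  have "(\<Union>a\<in>path_class X u. \<Union>b\<in>path_class X v. homotopy2 X `` {path_concat a b}) =
      (\<Union>a\<in>path_class X u. \<Union>b\<in>path_class X v. path_class X (u @ tl v))"
    by (intro SUP_cong refl path_class_concat[OF X u v uv])
  also have "\<dots> = path_class X (u @ tl v)"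
    using path_of_mem_path_class[OF X u] path_of_mem_path_class[OF X v] by auto
  finally show ?thesis by (simp add: fundamental_gpd_def)
qed

end

section \<open>The full subgroupoid on the points of \<open>R\<close>\<close>

definition walks_on :: "'a scomplex \<Rightarrow> 'a set \<Rightarrow> 'a list set" where
  "walks_on X R = {w. walk X w \<and> hd w \<in> R \<and> last w \<in> R}"

context
  fixes X :: "'a scomplex" and R :: "'a set"
  assumes X: "simplicial_complex X"
begin

lemma Obj_on: "Obj (fundamental_gpd_on X R) = R \<inter> points X"
  by (simp add: fundamental_gpd_on_def full_subgpd_def fundamental_gpd_def)

lemma Arr_on: "Arr (fundamental_gpd_on X R) = path_class X ` walks_on X R"
proof -
  have "Arr (fundamental_gpd_on X R) = {f \<in> path_class X ` {w. walk X w}.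
      Dom (fundamental_gpd X) f \<in> R \<and> Cod (fundamental_gpd X) f \<in> R}"
    by (simp add: fundamental_gpd_on_def full_subgpd_def fundamental_Arr[OF X])
  then show ?thesis by (auto simp: walks_on_def fundamental_Dom[OF X] fundamental_Cod[OF X])
qed

lemma Dom_on: "walk X w \<Longrightarrow> Dom (fundamental_gpd_on X R) (path_class X w) = hd w"
  and Cod_on: "walk X w \<Longrightarrow> Cod (fundamental_gpd_on X R) (path_class X w) = last w"
  and Ide_on: "Ide (fundamental_gpd_on X R) x = path_class X [x]"
  and Comp_on: "walk X u \<Longrightarrow> walk X v \<Longrightarrow> last u = hd v \<Longrightarrow>
    Comp (fundamental_gpd_on X R) (path_class X u) (path_class X v) = path_class X (u @ tl v)"
  using fundamental_Dom[OF X] fundamental_Cod[OF X] fundamental_Ide[OF X] fundamental_Comp[OF X]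
  by (simp_all add: fundamental_gpd_on_def full_subgpd_def)

lemma groupoid_on: "groupoid (fundamental_gpd_on X R)"
proof -
  let ?G = "fundamental_gpd_on X R"
  have arr: "\<exists>w. walk X w \<and> hd w \<in> R \<and> last w \<in> R \<and> f = path_class X w" if "f \<in> Arr ?G" for f
    using that by (auto simp: Arr_on walks_on_def)
  have arrI: "path_class X w \<in> Arr ?G" if "walk X w" "hd w \<in> R" "last w \<in> R" for w
    using that by (simp add: Arr_on walks_on_def)
  have eqI: "path_class X u = path_class X v" if "walk X u" "weq X u v" for u v
    using path_class_eq_iff[OF X] weq_walk[OF X] that by metis
  have last_glue: "last (u @ tl v) = last v" if "v \<noteq> []" "last u = hd v" for u v :: "'a list"
    using that by (cases v) auto
  show ?thesis
    unfolding groupoid_def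
  proof (intro conjI ballI impI)
    show "Dom ?G \<in> Arr ?G \<rightarrow> Obj ?G" "Cod ?G \<in> Arr ?G \<rightarrow> Obj ?G"
      using walk_ends[of X] by (auto dest!: arr simp: Dom_on Cod_on Obj_on)
  next
    fix x assume "x \<in> Obj ?G"
    then have "walk X [x]" "x \<in> R" by (simp_all add: Obj_on walk_single)
    then show "Ide ?G x \<in> Arr ?G" "Dom ?G (Ide ?G x) = x" "Cod ?G (Ide ?G x) = x"
      using arrI[of "[x]"] by (simp_all add: Ide_on Dom_on Cod_on)
  next
    fix f g assume fg: "f \<in> Arr ?G" "g \<in> Arr ?G" "Cod ?G f = Dom ?G g"
    obtain u where u: "walk X u" "hd u \<in> R" "last u \<in> R" "f = path_class X u" using arr fg(1) by blast
    obtain v where v: "walk X v" "hd v \<in> R" "last v \<in> R" "g = path_class X v" using arr fg(2) by blast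
    have uv: "last u = hd v" using fg(3) u v by (simp add: Dom_on Cod_on)
    note w = walk_glue[OF u(1) v(1) uv] last_glue[OF walk_ne[OF v(1)] uv]
    show "Comp ?G f g \<in> Arr ?G" "Dom ?G (Comp ?G f g) = Dom ?G f" "Cod ?G (Comp ?G f g) = Cod ?G g"
      using u v w uv walk_ne[OF u(1)] arrI[OF w(1)] by (simp_all add: Comp_on Dom_on Cod_on)
  next
    fix f assume f: "f \<in> Arr ?G"
    obtain u where u: "walk X u" "hd u \<in> R" "last u \<in> R" "f = path_class X u" using arr f by blast
    note ends = walk_ends[OF u(1)] walk_ne[OF u(1)]
    have "Comp ?G (path_class X [hd u]) (path_class X u) = path_class X ([hd u] @ tl u)"
      by (rule Comp_on) (use u ends in \<open>simp_all add: walk_single\<close>)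
    then show "Comp ?G (Ide ?G (Dom ?G f)) f = f"
      using u ends by (simp add: Dom_on Ide_on)
    have "Comp ?G (path_class X u) (path_class X [last u]) = path_class X (u @ tl [last u])"
      by (rule Comp_on) (use u ends in \<open>simp_all add: walk_single\<close>)
    then show "Comp ?G f (Ide ?G (Cod ?G f)) = f"
      using u by (simp add: Cod_on Ide_on)
    have r: "walk X (rev u)" "hd (rev u) = last u" "last (rev u) = hd u"
      using u(1) ends by (simp_all add: walk_rev hd_rev last_rev)
    show "\<exists>g\<in>Arr ?G. Dom ?G g = Cod ?G f \<and> Cod ?G g = Dom ?G f \<and>
        Comp ?G f g = Ide ?G (Dom ?G f) \<and> Comp ?G g f = Ide ?G (Cod ?G f)"
    proof (intro bexI conjI)
      show "path_class X (rev u) \<in> Arr ?G" using r u by (simp add: arrI)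
      show "Dom ?G (path_class X (rev u)) = Cod ?G f" "Cod ?G (path_class X (rev u)) = Dom ?G f"
        using r u by (simp_all add: Dom_on Cod_on)
      have "path_class X (u @ tl (rev u)) = path_class X [hd u]"
        by (rule eqI) (use walk_glue[OF u(1) r(1)] r weq_cancel_rev[OF X u(1)] in simp_all)
      then show "Comp ?G f (path_class X (rev u)) = Ide ?G (Dom ?G f)"
        using u r by (simp add: Comp_on Dom_on Ide_on)
      have "path_class X (rev u @ tl u) = path_class X [last u]"
        by (rule eqI) (use walk_glue[OF r(1) u(1)] r weq_rev_cancel[OF X u(1)] in simp_all)
      then show "Comp ?G (path_class X (rev u)) f = Ide ?G (Cod ?G f)"
        using u r by (simp add: Comp_on Cod_on Ide_on)
    qed
  next
    fix f g h assume fgh: "f \<in> Arr ?G" "g \<in> Arr ?G" "h \<in> Arr ?G" "Cod ?G f = Dom ?G g" "Cod ?G g = Dom ?G h"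
    obtain u where u: "walk X u" "f = path_class X u" using arr fgh(1) by blast
    obtain v where v: "walk X v" "g = path_class X v" using arr fgh(2) by blast
    obtain w where w: "walk X w" "h = path_class X w" using arr fgh(3) by blast
    have uv: "last u = hd v" and vw: "last v = hd w" using fgh(4,5) u v w by (simp_all add: Dom_on Cod_on)
    \<comment> \<open>Gluing of words is strictly associative, so this identity requires no
      moves.\<close>
    have "Comp ?G (Comp ?G f g) h = path_class X ((u @ tl v) @ tl w)"
      using u v w uv vw last_glue[OF walk_ne[OF v(1)] uv] walk_glue[OF u(1) v(1) uv] by (simp add: Comp_on)
    moreover have "Comp ?G f (Comp ?G g h) = path_class X (u @ tl (v @ tl w))"
      using u v w uv vw walk_ne[OF v(1)] walk_glue[OF v(1) w(1) vw] by (simp add: Comp_on)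
    ultimately show "Comp ?G (Comp ?G f g) h = Comp ?G f (Comp ?G g h)"
      using walk_ne[OF v(1)] by simp
  qed
qed

end

section \<open>Functors induced by inclusions\<close>

lemma homotopy2_mono:
  assumes "points Y \<subseteq> points X" "linked Y \<subseteq> linked X"
  shows "homotopy2 Y \<subseteq> homotopy2 X"
proof -
  have m: "sc_map Z X f" if "sc_map Z Y f" for f :: "'c \<Rightarrow> 'a" and Z
    using that assms unfolding sc_map_def by blast
  then have "sc_path X a" if "sc_path Y a" for a using that unfolding sc_path_def by blast
  with m show ?thesis unfolding homotopy2_def by blast
qed

text \<open>A homotopy in \<open>Y\<close> is also one in \<open>X\<close>, so the functor keeps the
  word and changes only the complex in which its class is taken.\<close>

lemma inclusion_functor_path_class:
  assumes X: "simplicial_complex X" and Y: "subobject Y X" and w: "w \<in> walks_on Y R"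
  shows "snd (inclusion_functor_on Y X R) (path_class Y w) = path_class X w"
proof -
  have scY: "simplicial_complex Y" and sub: "points Y \<subseteq> points X" "linked Y \<subseteq> linked X"
    using Y by (simp_all add: subobject_def)
  have wY: "walk Y w" using w by (simp add: walks_on_def)
  have "(\<Union>a\<in>path_class Y w. homotopy2 X `` {id \<circ> a}) = (\<Union>a\<in>path_class Y w. path_class X w)"
  proof (intro SUP_cong refl)
    fix a assume "a \<in> path_class Y w"
    then have "(path_of w, a) \<in> homotopy2 X"
      using homotopy2_mono[OF sub] by (auto simp: path_class_def)
    then show "homotopy2 X `` {id \<circ> a} = path_class X w"
      using homotopy2_class_eq[OF X] by (simp add: path_class_def)
  qed
  also have "\<dots> = path_class X w" using path_of_mem_path_class[OF scY wY] by auto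
  finally show ?thesis
    using w wY by (simp add: inclusion_functor_on_def functor_restrict_def fundamental_functor_def
        Arr_on[OF scY] fundamental_Arr[OF scY])
qed

lemma inclusion_functor_obj:
  "fst (inclusion_functor_on Y X R) = (\<lambda>x\<in>R \<inter> points Y. x)"
  by (auto simp: inclusion_functor_on_def functor_restrict_def fundamental_functor_def
      fundamental_gpd_on_def full_subgpd_def fundamental_gpd_def fun_eq_iff restrict_def)

lemma inclusion_functor_extensional:
  "simplicial_complex Y \<Longrightarrow> snd (inclusion_functor_on Y X R) \<in> extensional (path_class Y ` walks_on Y R)"
  by (simp add: inclusion_functor_on_def functor_restrict_def Arr_on)

lemma inclusion_functor:
  assumes X: "simplicial_complex X" and Y: "subobject Y X"
  shows "gpd_functor (fundamental_gpd_on Y R) (fundamental_gpd_on X R) (inclusion_functor_on Y X R)"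
proof -
  have scY: "simplicial_complex Y" and sub: "points Y \<subseteq> points X" "linked Y \<subseteq> linked X"
    using Y by (simp_all add: subobject_def)
  note walkX = walk_subobject[OF sub]
  have on: "u \<in> walks_on X R" if "u \<in> walks_on Y R" for u
    using that walkX by (auto simp: walks_on_def)
  note F = inclusion_functor_path_class[OF X Y, of _ R]
  show ?thesis
    unfolding gpd_functor_def
  proof (intro conjI ballI impI)
    show "fst (inclusion_functor_on Y X R) \<in> Obj (fundamental_gpd_on Y R) \<rightarrow>\<^sub>E Obj (fundamental_gpd_on X R)"
      using sub by (auto simp: Obj_on[OF scY] Obj_on[OF X] inclusion_functor_obj)
    show "snd (inclusion_functor_on Y X R) \<in> Arr (fundamental_gpd_on Y R) \<rightarrow>\<^sub>E Arr (fundamental_gpd_on X R)"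
      using inclusion_functor_extensional[OF scY, of X R] on
      by (auto simp: PiE_def Arr_on[OF scY] Arr_on[OF X] F)
  next
    fix f assume "f \<in> Arr (fundamental_gpd_on Y R)"
    then obtain w where w: "w \<in> walks_on Y R" "f = path_class Y w" by (auto simp: Arr_on[OF scY])
    then have "walk Y w" "hd w \<in> R \<inter> points Y" "last w \<in> R \<inter> points Y"
      using walk_ends[of Y w] by (auto simp: walks_on_def)
    then show "Dom (fundamental_gpd_on X R) (snd (inclusion_functor_on Y X R) f) =
        fst (inclusion_functor_on Y X R) (Dom (fundamental_gpd_on Y R) f)"
      "Cod (fundamental_gpd_on X R) (snd (inclusion_functor_on Y X R) f) =
        fst (inclusion_functor_on Y X R) (Cod (fundamental_gpd_on Y R) f)"
      using w walkX by (simp_all add: F Dom_on[OF scY] Dom_on[OF X] Cod_on[OF scY] Cod_on[OF X]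
          inclusion_functor_obj)
  next
    fix x assume "x \<in> Obj (fundamental_gpd_on Y R)"
    then have "x \<in> R \<inter> points Y" "[x] \<in> walks_on Y R"
      by (auto simp: Obj_on[OF scY] walks_on_def walk_single)
    then show "snd (inclusion_functor_on Y X R) (Ide (fundamental_gpd_on Y R) x) =
        Ide (fundamental_gpd_on X R) (fst (inclusion_functor_on Y X R) x)"
      by (simp add: Ide_on[OF scY] Ide_on[OF X] F inclusion_functor_obj)
  next
    fix f g assume "f \<in> Arr (fundamental_gpd_on Y R)" "g \<in> Arr (fundamental_gpd_on Y R)"
      and fg: "Cod (fundamental_gpd_on Y R) f = Dom (fundamental_gpd_on Y R) g"
    then obtain u v where u: "u \<in> walks_on Y R" "f = path_class Y u"
      and v: "v \<in> walks_on Y R" "g = path_class Y v" by (auto simp: Arr_on[OF scY])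
    have wu: "walk Y u" and wv: "walk Y v" using u v by (simp_all add: walks_on_def)
    then have uv: "last u = hd v" using fg u v by (simp add: Dom_on[OF scY] Cod_on[OF scY])
    have "last (u @ tl v) = last v" using walk_ne[OF wv] uv by (cases v) auto
    then have "u @ tl v \<in> walks_on Y R"
      using u v walk_glue[OF wu wv uv] walk_ne[OF wu] by (simp add: walks_on_def)
    then show "snd (inclusion_functor_on Y X R) (Comp (fundamental_gpd_on Y R) f g) =
        Comp (fundamental_gpd_on X R) (snd (inclusion_functor_on Y X R) f) (snd (inclusion_functor_on Y X R) g)"
      using u v wu wv uv walkX by (simp add: Comp_on[OF scY] Comp_on[OF X] F)
  qed
qed

section \<open>Products along walks\<close>

text \<open>A word of one letter still has a vertex, which carries an identity. The empty word has
  none, hence \<open>undefined\<close>; walks are nonempty.\<close>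

fun walk_prod :: "('o, 'm) gpd \<Rightarrow> ('a \<Rightarrow> 'o) \<Rightarrow> ('a \<Rightarrow> 'a \<Rightarrow> 'm) \<Rightarrow> 'a list \<Rightarrow> 'm" where
  "walk_prod D ob e [] = undefined"
| "walk_prod D ob e [x] = Ide D (ob x)"
| "walk_prod D ob e (x # y # ys) = Comp D (e x y) (walk_prod D ob e (y # ys))"

lemma walk_prod_Cons:
  "w \<noteq> [] \<Longrightarrow> walk_prod D ob e (x # w) = Comp D (e x (hd w)) (walk_prod D ob e w)"
  by (cases w) simp_all

text \<open>A prefix meets the rest of the word only through the first letter of the rest and
  through its product.\<close>

lemma walk_prod_append_cong:
  assumes "u \<noteq> []" "v \<noteq> []" "hd u = hd v" "walk_prod D ob e u = walk_prod D ob e v"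
  shows "walk_prod D ob e (xs @ u) = walk_prod D ob e (xs @ v)"
proof (induction xs)
  case (Cons x xs)
  then show ?case using assms by (simp add: walk_prod_Cons hd_append)
qed (use assms in simp)

lemma walk_suffix: "walk X (xs @ t) \<Longrightarrow> t \<noteq> [] \<Longrightarrow> walk X t"
  by (simp add: walk_def successively_append_iff)

lemma groupoid_IdeD:
  assumes "groupoid D" "x \<in> Obj D"
  shows "Ide D x \<in> Arr D" "Dom D (Ide D x) = x" "Cod D (Ide D x) = x"
  using assms unfolding groupoid_def by blast+

lemma groupoid_CompD:
  assumes "groupoid D" "f \<in> Arr D" "g \<in> Arr D" "Cod D f = Dom D g"
  shows "Comp D f g \<in> Arr D" "Dom D (Comp D f g) = Dom D f" "Cod D (Comp D f g) = Cod D g"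
  using assms unfolding groupoid_def by blast+

lemma groupoid_unit:
  assumes "groupoid D" "f \<in> Arr D"
  shows "Comp D (Ide D (Dom D f)) f = f" "Comp D f (Ide D (Cod D f)) = f"
  using assms unfolding groupoid_def by blast+

lemma groupoid_assoc:
  assumes "groupoid D" "f \<in> Arr D" "g \<in> Arr D" "h \<in> Arr D" "Cod D f = Dom D g" "Cod D g = Dom D h"
  shows "Comp D (Comp D f g) h = Comp D f (Comp D g h)"
  using assms unfolding groupoid_def by blast

text \<open>A nonabelian 1-cocycle with values in the groupoid \<open>D\<close>. The conditions
  \<open>edge_refl\<close> and \<open>triangle\<close> correspond to the moves \<open>dup\<close>
  and \<open>tri\<close>. The case \<open>z = x\<close> of \<open>triangle\<close> makes
  \<open>e x y\<close> and \<open>e y x\<close> mutually inverse.\<close>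

locale edge_cocycle =
  fixes X :: "'a scomplex" and D :: "('p, 'n) gpd" and ob :: "'a \<Rightarrow> 'p" and e :: "'a \<Rightarrow> 'a \<Rightarrow> 'n"
  assumes X: "simplicial_complex X" and D: "groupoid D"
    and ob: "x \<in> points X \<Longrightarrow> ob x \<in> Obj D"
    and edge: "{x, y} \<in> linked X \<Longrightarrow> e x y \<in> Arr D"
      "{x, y} \<in> linked X \<Longrightarrow> Dom D (e x y) = ob x"
      "{x, y} \<in> linked X \<Longrightarrow> Cod D (e x y) = ob y"
    and edge_refl: "x \<in> points X \<Longrightarrow> e x x = Ide D (ob x)"
    and triangle: "{x, y, z} \<in> linked X \<Longrightarrow> Comp D (e x y) (e y z) = e x z"
begin

abbreviation "prd \<equiv> walk_prod D ob e"

lemma prd_arr: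
  assumes "walk X w"
  shows "prd w \<in> Arr D \<and> Dom D (prd w) = ob (hd w) \<and> Cod D (prd w) = ob (last w)"
  using assms
proof (induction w rule: induct_list012)
  case (2 x)
  then show ?case using groupoid_IdeD[OF D ob] by (simp add: walk_single)
next
  case (3 x y ys)
  then show ?case using groupoid_CompD[OF D, of "e x y" "prd (y # ys)"] edge[of x y]
    by (simp add: walk_Cons2[OF X])
qed (simp add: walk_def)

lemma prd_glue:
  assumes "walk X u" "walk X v" "last u = hd v"
  shows "prd (u @ tl v) = Comp D (prd u) (prd v)"
  using assms(1,3)
proof (induction u rule: induct_list012)
  case (2 x)
  have "x # tl v = v" using 2 walk_ne[OF assms(2)] by simp
  then show ?case using 2 prd_arr[OF assms(2)] groupoid_unit(1)[OF D, of "prd v"] by simp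
next
  case (3 x y ys)
  then have w: "{x, y} \<in> linked X" "walk X (y # ys)" by (simp_all add: walk_Cons2[OF X])
  have "prd ((x # y # ys) @ tl v) = Comp D (e x y) (Comp D (prd (y # ys)) (prd v))"
    using 3 w by simp
  also have "\<dots> = Comp D (Comp D (e x y) (prd (y # ys))) (prd v)"
    by (rule groupoid_assoc[OF D, symmetric])
      (use 3 w edge prd_arr[OF w(2)] prd_arr[OF assms(2)] in simp_all)
  finally show ?case by simp
qed (simp add: walk_def)

lemma prd_move:
  assumes u: "walk X u" and "move X u v"
  shows "prd u = prd v"
  using assms(2)
proof cases
  case (dup xs x ys)
  have w: "walk X (x # ys)" using walk_suffix[of X xs] u dup by simp
  then have "prd (x # x # ys) = prd (x # ys)"
    using prd_arr[OF w] groupoid_unit(1)[OF D, of "prd (x # ys)"] edge_refl[of x] walk_ends(1)[OF w] by simp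
  then show ?thesis unfolding dup by (intro walk_prod_append_cong) simp_all
next
  case (tri x y z xs ys)
  have w: "walk X (z # ys)" using walk_suffix[of X "xs @ [x]"] u tri by simp
  have l: "{x, y} \<in> linked X" "{y, z} \<in> linked X" using linked_subset[OF X tri(3)] by auto
  have "prd (x # y # z # ys) = Comp D (Comp D (e x y) (e y z)) (prd (z # ys))"
    using groupoid_assoc[OF D, of "e x y" "e y z" "prd (z # ys)"] edge l prd_arr[OF w] by simp
  then have "prd (x # z # ys) = prd (x # y # z # ys)" using triangle[OF tri(3)] by simp
  then show ?thesis unfolding tri(1,2) by (intro walk_prod_append_cong) simp_all
qed

lemma prd_weq:
  assumes "weq X u v" and u: "walk X u"
  shows "prd u = prd v"
  using assms(1)
proof induction
  case (step y z)
  have "walk X y" using weq_walk[OF X step(1)] u by simp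
  moreover have "walk X z" using step(2) move_walk[OF X] \<open>walk X y\<close> by blast
  ultimately show ?case using step(2,3) prd_move by metis
qed simp

end

section \<open>Moving walks to end points in \<open>R\<close>\<close>

text \<open>Conjugation of \<open>w\<close> by the walks \<open>g\<close>: from \<open>R\<close>
  back to the start of \<open>w\<close>, along \<open>w\<close>, and out to \<open>R\<close> again.
  Each \<open>tl\<close> drops a vertex shared at a junction.\<close>

definition based :: "('a \<Rightarrow> 'a list) \<Rightarrow> 'a list \<Rightarrow> 'a list" where
  "based g w = rev (g (hd w)) @ tl w @ tl (g (last w))"

text \<open>The complex is a parameter so that a single family \<open>g\<close> can serve U, V,
  their intersection and X.\<close>

locale base_walks =
  fixes Y :: "'a scomplex" and R :: "'a set" and g :: "'a \<Rightarrow> 'a list"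
  assumes Y: "simplicial_complex Y"
    and g_walk: "x \<in> points Y \<Longrightarrow> walk Y (g x)"
    and g_hd: "x \<in> points Y \<Longrightarrow> hd (g x) = x"
    and g_last: "x \<in> points Y \<Longrightarrow> last (g x) \<in> R"
begin

lemma last_glue: "v \<noteq> [] \<Longrightarrow> last u = hd v \<Longrightarrow> last (u @ tl v) = last v"
  by (cases v) auto

lemma rev_glue_walk:
  assumes w: "walk Y w"
  shows "walk Y (rev (g (hd w)) @ tl w)" "last (rev (g (hd w)) @ tl w) = last w"
    "hd (rev (g (hd w)) @ tl w) = last (g (hd w))"
proof -
  note h = walk_ends(1)[OF w]
  have l: "last (rev (g (hd w))) = hd w" using g_hd[OF h] walk_ne[OF g_walk[OF h]] by (simp add: last_rev)
  show "walk Y (rev (g (hd w)) @ tl w)" using walk_glue[OF _ w l] g_walk[OF h] by (simp add: walk_rev)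
  show "last (rev (g (hd w)) @ tl w) = last w" by (rule last_glue[OF walk_ne[OF w] l])
  show "hd (rev (g (hd w)) @ tl w) = last (g (hd w))"
    using walk_ne[OF g_walk[OF h]] by (simp add: hd_rev)
qed

lemma based_walk:
  assumes w: "walk Y w"
  shows "walk Y (based g w)" "hd (based g w) = last (g (hd w))" "last (based g w) = last (g (last w))"
    "based g w \<in> walks_on Y R"
proof -
  note r = rev_glue_walk[OF w]
  note gl = g_walk[OF walk_ends(2)[OF w]] g_hd[OF walk_ends(2)[OF w]]
  have b: "based g w = (rev (g (hd w)) @ tl w) @ tl (g (last w))" by (simp add: based_def)
  show 1: "walk Y (based g w)" unfolding b using walk_glue[OF r(1) gl(1)] r(2) gl(2) by simp
  show 2: "hd (based g w) = last (g (hd w))"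
    unfolding b using r(3) walk_ne[OF r(1)] by (simp only: hd_append if_False)
  show 3: "last (based g w) = last (g (last w))"
    unfolding b using r(2) gl(2) by (intro last_glue[OF walk_ne[OF gl(1)]]) simp
  show "based g w \<in> walks_on Y R"
    using 1 2 3 g_last walk_ends[OF w] by (simp add: walks_on_def)
qed

lemma based_weq:
  assumes u: "walk Y u" and uv: "weq Y u v"
  shows "weq Y (based g u) (based g v)"
proof -
  have v: "walk Y v" using u weq_walk[OF Y uv] by simp
  note ends = weq_ends[OF uv]
  have "weq Y (rev (g (hd u)) @ tl u) (rev (g (hd u)) @ tl v)"
    by (rule weq_glue[OF _ uv])
      (use u g_walk[OF walk_ends(1)[OF u]] g_hd[OF walk_ends(1)[OF u]] in \<open>simp_all add: walk_ne last_rev\<close>)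
  from weq_append[OF this, of "[]" "tl (g (last u))"] show ?thesis
    using ends by (simp add: based_def)
qed

text \<open>At the junction the walk \<open>g (hd v)\<close> is followed out to \<open>R\<close> and
  straight back, and this detour cancels.\<close>

lemma based_glue:
  assumes u: "walk Y u" and v: "walk Y v" and uv: "last u = hd v"
  shows "weq Y (based g u @ tl (based g v)) (based g (u @ tl v))"
proof -
  define p where "p = rev (g (hd u)) @ tl u"
  define m where "m = g (hd v)"
  have m: "walk Y m" "hd m = hd v"
    using g_walk g_hd walk_ends(1)[OF v] by (simp_all add: m_def)
  note p = rev_glue_walk[OF u, folded p_def]
  have "weq Y (p @ tl (m @ tl (rev m))) (p @ tl [hd m])"
    by (rule weq_glue[OF _ weq_cancel_rev[OF Y m(1)]])
      (use p m uv walk_ne[OF m(1)] walk_ne[OF p(1)] in simp_all)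
  from weq_append[OF this, of "[]" "tl v @ tl (g (last v))"]
  have "weq Y (p @ tl m @ tl (rev m) @ tl v @ tl (g (last v))) (p @ tl v @ tl (g (last v)))"
    using walk_ne[OF m(1)] by simp
  moreover have "based g u @ tl (based g v) = p @ tl m @ tl (rev m) @ tl v @ tl (g (last v))"
    using walk_ne[OF m(1)] uv by (simp add: based_def p_def m_def)
  moreover have "based g (u @ tl v) = p @ tl v @ tl (g (last v))"
    using last_glue[OF walk_ne[OF v] uv] walk_ne[OF u] by (simp add: based_def p_def)
  ultimately show ?thesis by simp
qed

lemma based_single:
  assumes "x \<in> points Y"
  shows "weq Y (based g [x]) [last (g x)]"
  using weq_rev_cancel[OF Y g_walk[OF assms]] by (simp add: based_def)

lemma based_class_weq:
  assumes "walk Y u" "weq Y u v"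
  shows "path_class Y (based g u) = path_class Y (based g v)"
  using path_class_eq_iff[OF Y] based_weq[OF assms] based_walk(1) assms weq_walk[OF Y] by metis

lemma based_class_single:
  assumes "x \<in> points Y"
  shows "path_class Y (based g [x]) = path_class Y [last (g x)]"
  using path_class_eq_iff[OF Y] based_single[OF assms] weq_walk[OF Y] based_walk(1)[of "[x]"] assms
  by (metis walk_single)

lemma based_class_glue:
  assumes u: "walk Y u" and v: "walk Y v" and uv: "last u = hd v"
  shows "path_class Y (based g (u @ tl v)) =
    Comp (fundamental_gpd_on Y R) (path_class Y (based g u)) (path_class Y (based g v))"
proof -
  have "Comp (fundamental_gpd_on Y R) (path_class Y (based g u)) (path_class Y (based g v)) =
      path_class Y (based g u @ tl (based g v))"
    by (rule Comp_on[OF Y]) (use based_walk[OF u] based_walk[OF v] uv in simp_all)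
  also have "\<dots> = path_class Y (based g (u @ tl v))"
    using path_class_eq_iff[OF Y] based_glue[OF u v uv] weq_walk[OF Y] based_walk(1)[OF walk_glue[OF u v uv]]
    by metis
  finally show ?thesis by simp
qed

end

text \<open>\<open>F\<close> has values only over \<open>R\<close>. Conjugation by \<open>g\<close>
  extends it to every vertex and every edge of \<open>Y\<close>, through \<open>edge_ob\<close> and
  \<open>edge_arr\<close>.\<close>

locale based_functor = base_walks Y R g
  for Y :: "'a scomplex" and R g +
  fixes D :: "('p, 'n) gpd" and F :: "('a \<Rightarrow> 'p) \<times> ((int \<Rightarrow> 'a) set \<Rightarrow> 'n)"
  assumes D: "groupoid D" and F: "gpd_functor (fundamental_gpd_on Y R) D F"
begin

abbreviation "edge_ob x \<equiv> fst F (last (g x))"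
abbreviation "edge_arr x y \<equiv> snd F (path_class Y (based g [x, y]))"

lemma F_class:
  assumes "w \<in> walks_on Y R"
  shows "snd F (path_class Y w) \<in> Arr D" "Dom D (snd F (path_class Y w)) = fst F (hd w)"
    "Cod D (snd F (path_class Y w)) = fst F (last w)"
proof -
  have "path_class Y w \<in> Arr (fundamental_gpd_on Y R)" "walk Y w"
    using assms by (auto simp: Arr_on[OF Y] walks_on_def)
  then show "snd F (path_class Y w) \<in> Arr D" "Dom D (snd F (path_class Y w)) = fst F (hd w)"
    "Cod D (snd F (path_class Y w)) = fst F (last w)"
    using F Dom_on[OF Y, of w R] Cod_on[OF Y, of w R] unfolding gpd_functor_def by (auto simp: PiE_iff)
qed

lemma F_Ide:
  assumes "x \<in> R \<inter> points Y"
  shows "snd F (path_class Y [x]) = Ide D (fst F x)"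
proof -
  have "snd F (Ide (fundamental_gpd_on Y R) x) = Ide D (fst F x)"
    using F assms unfolding gpd_functor_def Obj_on[OF Y] by blast
  then show ?thesis by (simp add: Ide_on[OF Y])
qed

lemma F_glue:
  assumes "walk Y u" "walk Y v" "last u = hd v"
  shows "snd F (path_class Y (based g (u @ tl v))) =
    Comp D (snd F (path_class Y (based g u))) (snd F (path_class Y (based g v)))"
proof -
  have "path_class Y (based g u) \<in> Arr (fundamental_gpd_on Y R)"
    "path_class Y (based g v) \<in> Arr (fundamental_gpd_on Y R)"
    using based_walk(4) assms by (simp_all add: Arr_on[OF Y])
  moreover have "Cod (fundamental_gpd_on Y R) (path_class Y (based g u)) =
      Dom (fundamental_gpd_on Y R) (path_class Y (based g v))"
    using based_walk[OF assms(1)] based_walk[OF assms(2)] assms(3)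
    by (simp add: Cod_on[OF Y] Dom_on[OF Y])
  ultimately show ?thesis
    using F unfolding gpd_functor_def based_class_glue[OF assms] by blast
qed

lemma g_end: "x \<in> points Y \<Longrightarrow> last (g x) \<in> R \<inter> points Y"
  using g_last walk_ends(2)[OF g_walk] by blast

text \<open>Functoriality of \<open>F\<close> turns products of edge arrows into values on longer
  words. The identities then come from the equivalences of \<open>[x, x]\<close> with
  \<open>[x]\<close> and of \<open>[x, y, z]\<close> with \<open>[x, z]\<close>.\<close>

lemma edge_cocycle: "edge_cocycle Y D edge_ob edge_arr"
proof
  fix x y z
  show "edge_ob x \<in> Obj D" if "x \<in> points Y"
    using F g_end[OF that] unfolding gpd_functor_def by (auto simp: PiE_iff Obj_on[OF Y])
  show "edge_arr x y \<in> Arr D" "Dom D (edge_arr x y) = edge_ob x" "Cod D (edge_arr x y) = edge_ob y"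
    if "{x, y} \<in> linked Y"
  proof -
    have "walk Y [x, y]" using that by (simp add: walk_pair[OF Y])
    from F_class[OF based_walk(4)[OF this]] based_walk(2,3)[OF this]
    show "edge_arr x y \<in> Arr D" "Dom D (edge_arr x y) = edge_ob x" "Cod D (edge_arr x y) = edge_ob y"
      by simp_all
  qed
  show "edge_arr x x = Ide D (edge_ob x)" if "x \<in> points Y"
  proof -
    have "walk Y [x, x]" using linked_single[OF Y that] by (simp add: walk_pair[OF Y])
    moreover have "weq Y [x, x] [x]" using weq_dup[of Y "[]" x "[]"] by simp
    ultimately have "path_class Y (based g [x, x]) = path_class Y (based g [x])"
      by (rule based_class_weq)
    then show ?thesis using based_class_single[OF that] F_Ide[OF g_end[OF that]] by simp
  qed
  show "Comp D (edge_arr x y) (edge_arr y z) = edge_arr x z" if "{x, y, z} \<in> linked Y"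
  proof -
    have w: "walk Y [x, y]" "walk Y [y, z]"
      using linked_subset[OF Y that] by (simp_all add: walk_pair[OF Y])
    have "Comp D (edge_arr x y) (edge_arr y z) = snd F (path_class Y (based g [x, y, z]))"
      using F_glue[OF w] by simp
    also have "path_class Y (based g [x, y, z]) = path_class Y (based g [x, z])"
    proof (rule based_class_weq)
      show "walk Y [x, y, z]" using walk_glue[OF w] by simp
      show "weq Y [x, y, z] [x, z]" using weq_tri[OF that, of "[]" "[]"] by simp
    qed
    finally show ?thesis .
  qed
qed (use Y D in auto)

text \<open>\<open>ob\<close> and \<open>e\<close> are only required to agree with the data of
  \<open>F\<close> on \<open>Y\<close>, because the lemma is applied to a cocycle on X that is glued
  from two functors.\<close>

lemma walk_prod_eq:
  assumes "walk Y w"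
    and ob: "\<And>x. x \<in> points Y \<Longrightarrow> ob x = edge_ob x"
    and e: "\<And>x y. {x, y} \<in> linked Y \<Longrightarrow> e x y = edge_arr x y"
  shows "walk_prod D ob e w = snd F (path_class Y (based g w))"
  using assms(1)
proof (induction w rule: induct_list012)
  case (2 x)
  then have "x \<in> points Y" by (simp add: walk_single)
  then show ?case using ob based_class_single F_Ide[OF g_end] by simp
next
  case (3 x y ys)
  then have w: "{x, y} \<in> linked Y" "walk Y (y # ys)" by (simp_all add: walk_Cons2[OF Y])
  then have "walk Y [x, y]" by (simp add: walk_pair[OF Y])
  from F_glue[OF this w(2)] show ?case using 3 w e[OF w(1)] by simp
qed (simp add: walk_def)

end

lemma representative_walk:
  assumes Y: "simplicial_complex Y" and R: "representative R Y" and x: "x \<in> points Y"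
  shows "\<exists>w. walk Y w \<and> hd w = x \<and> last w \<in> R"
proof -
  let ?E = "{(y, y'). y \<in> points Y \<and> y' \<in> points Y \<and> equivclp (\<lambda>u v. {u, v} \<in> linked Y) y y'}"
  have "?E `` {x} \<in> path_components Y" unfolding path_components_def using x by (rule quotientI)
  then have "R \<inter> ?E `` {x} \<noteq> {}" using R unfolding representative_def by blast
  then obtain r where r: "r \<in> R" "equivclp (\<lambda>u v. {u, v} \<in> linked Y) x r" by auto
  from r(2) have "\<exists>w. walk Y w \<and> hd w = x \<and> last w = r"
  proof induction
    case base
    have "walk Y [x]" using x by (simp add: walk_single)
    then show ?case by (intro exI[of _ "[x]"]) simp
  next
    case (step y z)
    then obtain w where w: "walk Y w" "hd w = x" "last w = y" by blast
    have "walk Y [y, z]" using step(2) by (auto simp: walk_pair[OF Y] insert_commute)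
    then have "walk Y (w @ tl [y, z])" using walk_glue[OF w(1), of "[y, z]"] w(3) by simp
    then show ?case using w walk_ne[OF w(1)] by (intro exI[of _ "w @ [z]"]) simp
  qed
  with r(1) show ?thesis by blast
qed

section \<open>The pushout square\<close>

lemma simplicial_complex_inter:
  assumes "simplicial_complex U" "simplicial_complex V"
  shows "simplicial_complex (sc_inter U V)"
  using assms unfolding simplicial_complex_def sc_inter_def by auto

text \<open>With the intersection as \<open>W\<close>, and with U and then V in the middle, both
  composites of the square become the functor of the intersection into X. This is its
  commutativity.\<close>

lemma inclusion_functor_comp:
  assumes X: "simplicial_complex X" and U: "subobject U X" and W: "subobject W U"
  shows "functor_comp (fundamental_gpd_on W R) (inclusion_functor_on U X R) (inclusion_functor_on W U R)
    = inclusion_functor_on W X R"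
proof -
  have scU: "simplicial_complex U" and scW: "simplicial_complex W" and WX: "subobject W X"
    using U W by (auto simp: subobject_def)
  have on: "w \<in> walks_on U R" if "w \<in> walks_on W R" for w
    using that W walk_subobject[of W U w] by (auto simp: walks_on_def subobject_def)
  show ?thesis
  proof (rule prod_eqI)
    show "fst (functor_comp (fundamental_gpd_on W R) (inclusion_functor_on U X R) (inclusion_functor_on W U R)) =
        fst (inclusion_functor_on W X R)"
      using W by (auto simp: functor_comp_def inclusion_functor_obj Obj_on[OF scW] subobject_def
          compose_def restrict_def fun_eq_iff)
    show "snd (functor_comp (fundamental_gpd_on W R) (inclusion_functor_on U X R) (inclusion_functor_on W U R)) =
        snd (inclusion_functor_on W X R)"
    proof (rule extensionalityI)
      show "snd (functor_comp (fundamental_gpd_on W R) (inclusion_functor_on U X R) (inclusion_functor_on W U R))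
          \<in> extensional (path_class W ` walks_on W R)"
        by (simp add: functor_comp_def Arr_on[OF scW])
      show "snd (inclusion_functor_on W X R) \<in> extensional (path_class W ` walks_on W R)"
        by (rule inclusion_functor_extensional[OF scW])
    next
      fix \<alpha> assume "\<alpha> \<in> path_class W ` walks_on W R"
      then show "snd (functor_comp (fundamental_gpd_on W R) (inclusion_functor_on U X R)
          (inclusion_functor_on W U R)) \<alpha> = snd (inclusion_functor_on W X R) \<alpha>"
        using on by (auto simp: functor_comp_def compose_eq Arr_on[OF scW]
            inclusion_functor_path_class[OF scU W] inclusion_functor_path_class[OF X U]
            inclusion_functor_path_class[OF X WX])
    qed
  qed
qed

section \<open>Equations between functors, tested on words\<close>

lemma functor_comp_inclusionD:
  assumes X: "simplicial_complex X" and Y: "subobject Y X"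
    and eq: "functor_comp (fundamental_gpd_on Y R) T (inclusion_functor_on Y X R) = P"
  shows "x \<in> R \<inter> points Y \<Longrightarrow> fst T x = fst P x"
    and "w \<in> walks_on Y R \<Longrightarrow> snd T (path_class X w) = snd P (path_class Y w)"
proof -
  have scY: "simplicial_complex Y" using Y by (simp add: subobject_def)
  show "fst T x = fst P x" if "x \<in> R \<inter> points Y"
    using that unfolding eq[symmetric] by (simp add: functor_comp_def compose_eq Obj_on[OF scY] inclusion_functor_obj)
  show "snd T (path_class X w) = snd P (path_class Y w)" if "w \<in> walks_on Y R"
    using that unfolding eq[symmetric]
    by (simp add: functor_comp_def compose_eq Arr_on[OF scY] inclusion_functor_path_class[OF X Y])
qed

lemma functor_comp_inclusionI:
  assumes X: "simplicial_complex X" and Y: "subobject Y X"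
    and P: "gpd_functor (fundamental_gpd_on Y R) D P"
    and ob: "\<And>x. x \<in> R \<inter> points Y \<Longrightarrow> fst T x = fst P x"
    and arr: "\<And>w. w \<in> walks_on Y R \<Longrightarrow> snd T (path_class X w) = snd P (path_class Y w)"
  shows "functor_comp (fundamental_gpd_on Y R) T (inclusion_functor_on Y X R) = P"
proof -
  have scY: "simplicial_complex Y" using Y by (simp add: subobject_def)
  have ext: "fst P \<in> extensional (R \<inter> points Y)" "snd P \<in> extensional (path_class Y ` walks_on Y R)"
    using P unfolding gpd_functor_def PiE_def Obj_on[OF scY] Arr_on[OF scY] by blast+
  show ?thesis
  proof (rule prod_eqI)
    show "fst (functor_comp (fundamental_gpd_on Y R) T (inclusion_functor_on Y X R)) = fst P"
      by (rule extensionalityI[OF _ ext(1)])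
        (simp_all add: functor_comp_def compose_eq Obj_on[OF scY] inclusion_functor_obj ob)
    show "snd (functor_comp (fundamental_gpd_on Y R) T (inclusion_functor_on Y X R)) = snd P"
      by (rule extensionalityI[OF _ ext(2)])
        (auto simp: functor_comp_def compose_eq Arr_on[OF scY] inclusion_functor_path_class[OF X Y] arr)
  qed
qed

text \<open>An arrow is a class of walks, so some word has to be picked for it. By
  \<open>prd_weq\<close> the product is independent of the choice, and \<open>prd_glue\<close> then
  gives compatibility with composition.\<close>

lemma (in edge_cocycle) walk_prod_functor:
  fixes R
  defines "T \<equiv> (\<lambda>x\<in>R \<inter> points X. ob x,
    \<lambda>\<alpha>\<in>path_class X ` walks_on X R. prd (SOME w. w \<in> walks_on X R \<and> path_class X w = \<alpha>))"
  shows "gpd_functor (fundamental_gpd_on X R) D T"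
    and "w \<in> walks_on X R \<Longrightarrow> snd T (path_class X w) = prd w"
proof -
  have T: "snd T (path_class X w) = prd w" if w: "w \<in> walks_on X R" for w
  proof -
    define v where "v = (SOME v. v \<in> walks_on X R \<and> path_class X v = path_class X w)"
    have "v \<in> walks_on X R \<and> path_class X v = path_class X w"
      unfolding v_def by (rule someI[of _ w]) (use w in simp)
    then have "weq X v w" "walk X v"
      using path_class_eq_iff[OF X, of v w] w by (simp_all add: walks_on_def)
    then have "prd v = prd w" by (rule prd_weq)
    then show ?thesis using w by (simp add: T_def v_def)
  qed
  then show "w \<in> walks_on X R \<Longrightarrow> snd T (path_class X w) = prd w" .
  show "gpd_functor (fundamental_gpd_on X R) D T"
    unfolding gpd_functor_def
  proof (intro conjI ballI impI)
    show "fst T \<in> Obj (fundamental_gpd_on X R) \<rightarrow>\<^sub>E Obj D"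
      by (auto simp: T_def Obj_on[OF X] ob)
    have "snd T \<in> extensional (Arr (fundamental_gpd_on X R))" by (simp add: T_def Arr_on[OF X])
    then show "snd T \<in> Arr (fundamental_gpd_on X R) \<rightarrow>\<^sub>E Arr D"
      using prd_arr by (auto simp: PiE_def Arr_on[OF X] T walks_on_def)
  next
    fix f assume "f \<in> Arr (fundamental_gpd_on X R)"
    then obtain w where w: "w \<in> walks_on X R" "f = path_class X w" by (auto simp: Arr_on[OF X])
    then have wX: "walk X w" "hd w \<in> R" "last w \<in> R" by (simp_all add: walks_on_def)
    then have "fst T (hd w) = ob (hd w)" "fst T (last w) = ob (last w)"
      using walk_ends[of X w] by (simp_all add: T_def)
    then show "Dom D (snd T f) = fst T (Dom (fundamental_gpd_on X R) f)"
      "Cod D (snd T f) = fst T (Cod (fundamental_gpd_on X R) f)"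
      using w T[OF w(1)] prd_arr[OF wX(1)] wX(1) by (simp_all add: Dom_on[OF X] Cod_on[OF X])
  next
    fix x assume "x \<in> Obj (fundamental_gpd_on X R)"
    then have x: "x \<in> R" "x \<in> points X" by (simp_all add: Obj_on[OF X])
    then have "[x] \<in> walks_on X R" by (simp add: walks_on_def walk_single)
    from T[OF this] x show "snd T (Ide (fundamental_gpd_on X R) x) = Ide D (fst T x)"
      by (simp add: Ide_on[OF X]) (simp add: T_def)
  next
    fix f h assume "f \<in> Arr (fundamental_gpd_on X R)" "h \<in> Arr (fundamental_gpd_on X R)"
      and fh: "Cod (fundamental_gpd_on X R) f = Dom (fundamental_gpd_on X R) h"
    then obtain u v where u: "u \<in> walks_on X R" "f = path_class X u"
      and v: "v \<in> walks_on X R" "h = path_class X v" by (auto simp: Arr_on[OF X])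
    have wu: "walk X u" and wv: "walk X v" using u v by (simp_all add: walks_on_def)
    then have uv: "last u = hd v" using fh u v by (simp add: Dom_on[OF X] Cod_on[OF X])
    have "last (u @ tl v) = last v" using walk_ne[OF wv] uv by (cases v) auto
    then have "u @ tl v \<in> walks_on X R"
      using u v walk_glue[OF wu wv uv] walk_ne[OF wu] by (simp add: walks_on_def)
    then show "snd T (Comp (fundamental_gpd_on X R) f h) = Comp D (snd T f) (snd T h)"
      using u v wu wv uv prd_glue[OF wu wv uv] by (simp add: Comp_on[OF X] T)
  qed
qed

section \<open>The universal property of the square\<close>

lemma van_kampen_universal:
  fixes U V :: "'a scomplex" and D :: "('p, 'n) gpd"
  defines "X \<equiv> sc_union U V" and "W \<equiv> sc_inter U V"
  assumes X: "simplicial_complex X" and U: "subobject U X" and V: "subobject V X"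
    and rep: "representative R U" "representative R V" "representative R W"
    and D: "groupoid D"
    and P: "gpd_functor (fundamental_gpd_on U R) D P"
    and Q: "gpd_functor (fundamental_gpd_on V R) D Q"
    and PQ: "functor_comp (fundamental_gpd_on W R) P (inclusion_functor_on W U R)
      = functor_comp (fundamental_gpd_on W R) Q (inclusion_functor_on W V R)"
  shows "\<exists>!T. gpd_functor (fundamental_gpd_on X R) D T \<and>
    functor_comp (fundamental_gpd_on U R) T (inclusion_functor_on U X R) = P \<and>
    functor_comp (fundamental_gpd_on V R) T (inclusion_functor_on V X R) = Q"
proof -
  have scU: "simplicial_complex U" and scV: "simplicial_complex V"
    using U V by (simp_all add: subobject_def)
  have scW: "simplicial_complex W" unfolding W_def by (rule simplicial_complex_inter[OF scU scV])
  have WU: "subobject W U" and WV: "subobject W V"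
    using scW by (auto simp: subobject_def W_def sc_inter_def)
  have pX: "points X = points U \<union> points V" and lX: "linked X = linked U \<union> linked V"
    by (simp_all add: X_def sc_union_def)
  have pW: "points W = points U \<inter> points V" and lW: "linked W = linked U \<inter> linked V"
    by (simp_all add: W_def sc_inter_def)
  have walkWU: "walk U w" and walkWV: "walk V w" if "walk W w" for w
    using walk_subobject[of W U w] walk_subobject[of W V w] that pW lW by auto
  have walkUX: "walk X w" if "walk U w" for w using walk_subobject[of U X w] that pX lX by auto
  have walkVX: "walk X w" if "walk V w" for w using walk_subobject[of V X w] that pX lX by auto

  have PQ_ob: "fst P x = fst Q x" if "x \<in> R \<inter> points W" for x
    using functor_comp_inclusionD(1)[OF scU WU PQ that] functor_comp_inclusionD(1)[OF scV WV refl that, of Q] by simp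
  have PQ_arr: "snd P (path_class U w) = snd Q (path_class V w)" if "w \<in> walks_on W R" for w
    using functor_comp_inclusionD(2)[OF scU WU PQ that] functor_comp_inclusionD(2)[OF scV WV refl that, of Q] by simp

  \<comment> \<open>The conditions on \<open>w\<close> serve three ends: triviality on
    \<open>R\<close> keeps walks over \<open>R\<close> unchanged under conjugation, the end in
    \<open>R\<close> puts conjugated walks into the restricted groupoids, and over a common point
    the walk lies in both pieces.\<close>
  have "\<exists>w. (x \<in> R \<longrightarrow> w = [x]) \<and> hd w = x \<and> last w \<in> R \<and>
      (x \<in> points U \<longrightarrow> walk U w) \<and> (x \<in> points V \<longrightarrow> walk V w)" if x: "x \<in> points X" for x
  proof -
    consider "x \<in> R" | "x \<notin> R" "x \<in> points W" | "x \<notin> R" "x \<in> points U" "x \<notin> points V"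
      | "x \<notin> R" "x \<in> points V" "x \<notin> points U"
      using x pX pW by blast
    then show ?thesis
    proof cases
      case 1
      then show ?thesis by (intro exI[of _ "[x]"]) (simp add: walk_single)
    next
      case 2
      then show ?thesis using representative_walk[OF scW rep(3)] walkWU walkWV by blast
    next
      case 3
      then show ?thesis using representative_walk[OF scU rep(1)] by blast
    next
      case 4
      then show ?thesis using representative_walk[OF scV rep(2)] by blast
    qed
  qed
  then have "\<forall>x\<in>points X. \<exists>w. (x \<in> R \<longrightarrow> w = [x]) \<and> hd w = x \<and> last w \<in> R \<and>
      (x \<in> points U \<longrightarrow> walk U w) \<and> (x \<in> points V \<longrightarrow> walk V w)" by (rule ballI)
  from bchoice[OF this] obtain g where "\<forall>x\<in>points X. (x \<in> R \<longrightarrow> g x = [x]) \<and> hd (g x) = x \<and> last (g x) \<in> R \<and>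
      (x \<in> points U \<longrightarrow> walk U (g x)) \<and> (x \<in> points V \<longrightarrow> walk V (g x))" ..
  then have g: "x \<in> R \<Longrightarrow> g x = [x]" "hd (g x) = x" "last (g x) \<in> R"
      "x \<in> points U \<Longrightarrow> walk U (g x)" "x \<in> points V \<Longrightarrow> walk V (g x)" if "x \<in> points X" for x
    using that by simp_all
  \<comment> \<open>Edges linked both in U and in V are linked in the intersection, by definition of
    its linked parts.\<close>
  have gW: "walk W (g x)" if "x \<in> points W" for x
    using g(4,5)[of x] that pX pW lW by (auto simp: walk_def successively_conv_nth)

  interpret U: based_functor U R g D P
    by unfold_locales (use scU D P g pX in auto)
  interpret V: based_functor V R g D Q
    by unfold_locales (use scV D Q g pX in auto)
  interpret W: base_walks W R g
    by unfold_locales (use scW gW g pX pW in auto)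
  interpret XX: base_walks X R g
    by unfold_locales (use X walkUX walkVX g pX in auto)

  \<comment> \<open>The definitions prefer U. \<open>obV\<close> and \<open>eV\<close> show that V
    gives the same values: a common point or edge belongs to \<open>W\<close>, its conjugate stays
    in \<open>W\<close>, and there \<open>P\<close> and \<open>Q\<close> agree.\<close>
  define ob where "ob x = (if x \<in> points U then U.edge_ob x else V.edge_ob x)" for x
  define e where "e x y = (if {x, y} \<in> linked U then U.edge_arr x y else V.edge_arr x y)" for x y
  have obU: "ob x = U.edge_ob x" if "x \<in> points U" for x using that by (simp add: ob_def)
  have obV: "ob x = V.edge_ob x" if "x \<in> points V" for x
  proof (cases "x \<in> points U")
    case True
    then have "x \<in> points W" using that pW by simp
    then have "last (g x) \<in> R \<inter> points W" using W.g_last walk_ends(2)[OF gW] by blast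
    then show ?thesis using True PQ_ob by (simp add: ob_def)
  qed (simp add: ob_def)
  have eU: "e x y = U.edge_arr x y" if "{x, y} \<in> linked U" for x y using that by (simp add: e_def)
  have eV: "e x y = V.edge_arr x y" if "{x, y} \<in> linked V" for x y
  proof (cases "{x, y} \<in> linked U")
    case True
    then have "walk W [x, y]" using that lW by (simp add: walk_pair[OF scW])
    then show ?thesis using True PQ_arr[OF W.based_walk(4)] by (simp add: e_def)
  qed (simp add: e_def)

  interpret CU: edge_cocycle U D U.edge_ob U.edge_arr by (rule U.edge_cocycle)
  interpret CV: edge_cocycle V D V.edge_ob V.edge_arr by (rule V.edge_cocycle)
  interpret C: edge_cocycle X D ob e
  proof
    fix x y z
    show "ob x \<in> Obj D" if "x \<in> points X" using that pX obU obV CU.ob CV.ob by fastforce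
    show "e x y \<in> Arr D" "Dom D (e x y) = ob x" "Cod D (e x y) = ob y" if xy: "{x, y} \<in> linked X"
    proof -
      from xy lX consider "{x, y} \<in> linked U" | "{x, y} \<in> linked V" by blast
      then have "e x y \<in> Arr D \<and> Dom D (e x y) = ob x \<and> Cod D (e x y) = ob y"
      proof cases
        case 1
        then show ?thesis
          using CU.edge[OF 1] linked_points[OF scU 1, of x] linked_points[OF scU 1, of y] by (simp add: eU obU)
      next
        case 2
        then show ?thesis
          using CV.edge[OF 2] linked_points[OF scV 2, of x] linked_points[OF scV 2, of y] by (simp add: eV obV)
      qed
      then show "e x y \<in> Arr D" "Dom D (e x y) = ob x" "Cod D (e x y) = ob y" by simp_all
    qed
    show "e x x = Ide D (ob x)" if "x \<in> points X"
    proof (cases "x \<in> points U")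
      case True
      then show ?thesis using CU.edge_refl[OF True] linked_single[OF scU True] eU[of x x] obU by simp
    next
      case False
      then have xV: "x \<in> points V" using that pX by simp
      then show ?thesis using CV.edge_refl[OF xV] linked_single[OF scV xV] eV[of x x] obV by simp
    qed
    show "Comp D (e x y) (e y z) = e x z" if xyz: "{x, y, z} \<in> linked X"
    proof -
      \<comment> \<open>The triple as a whole lies in one piece, so all three edge values come from
        the same functor and its own triangle identity applies.\<close>
      from xyz lX consider "{x, y, z} \<in> linked U" | "{x, y, z} \<in> linked V" by blast
      then show ?thesis
      proof cases
        case 1
        have "{x, y} \<in> linked U" "{y, z} \<in> linked U" "{x, z} \<in> linked U"
          using linked_subset[OF scU 1] by auto
        then show ?thesis using CU.triangle[OF 1] by (simp add: eU)
      next
        case 2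
        have "{x, y} \<in> linked V" "{y, z} \<in> linked V" "{x, z} \<in> linked V"
          using linked_subset[OF scV 2] by auto
        then show ?thesis using CV.triangle[OF 2] by (simp add: eV)
      qed
    qed
  qed (use X D in auto)

  have prdU: "C.prd w = snd P (path_class U (based g w))" if "walk U w" for w
    by (rule U.walk_prod_eq[OF that obU eU])
  have prdV: "C.prd w = snd Q (path_class V (based g w))" if "walk V w" for w
    by (rule V.walk_prod_eq[OF that obV eV])
  \<comment> \<open>Both end points lie in \<open>R\<close>, where \<open>g\<close> is trivial. Thus
    \<open>prdU\<close> and \<open>prdV\<close> give the values of \<open>P\<close> and
    \<open>Q\<close> on the original words.\<close>
  have based_id: "based g w = w" if "w \<in> walks_on Y R" "points Y \<subseteq> points X" for w and Y :: "'a scomplex"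
  proof -
    have "hd w \<in> R" "last w \<in> R" "hd w \<in> points X" "last w \<in> points X" "w \<noteq> []"
      using that walk_ends[of Y w] walk_ne[of Y w] by (auto simp: walks_on_def)
    then show ?thesis using g(1) by (simp add: based_def)
  qed
  have on: "w \<in> walks_on X R" if "w \<in> walks_on U R \<or> w \<in> walks_on V R" for w
    using that walkUX walkVX by (auto simp: walks_on_def)
  define T where "T = (\<lambda>x\<in>R \<inter> points X. ob x,
    \<lambda>\<alpha>\<in>path_class X ` walks_on X R. C.prd (SOME w. w \<in> walks_on X R \<and> path_class X w = \<alpha>))"
  note T = C.walk_prod_functor[where R = R, folded T_def]

  show ?thesis
  proof (rule ex1I[of _ T])
    have "functor_comp (fundamental_gpd_on U R) T (inclusion_functor_on U X R) = P"
    proof (rule functor_comp_inclusionI[OF X U P])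
      show "fst T x = fst P x" if "x \<in> R \<inter> points U" for x
        using that pX obU g(1)[of x] by (simp add: T_def)
      show "snd T (path_class X w) = snd P (path_class U w)" if "w \<in> walks_on U R" for w
        using T(2)[of w] on[of w] prdU[of w] based_id[OF that] that pX by (simp add: walks_on_def)
    qed
    moreover have "functor_comp (fundamental_gpd_on V R) T (inclusion_functor_on V X R) = Q"
    proof (rule functor_comp_inclusionI[OF X V Q])
      show "fst T x = fst Q x" if "x \<in> R \<inter> points V" for x
        using that pX obV g(1)[of x] by (simp add: T_def)
      show "snd T (path_class X w) = snd Q (path_class V w)" if "w \<in> walks_on V R" for w
        using T(2)[of w] on[of w] prdV[of w] based_id[OF that] that pX by (simp add: walks_on_def)
    qed
    ultimately show "gpd_functor (fundamental_gpd_on X R) D T \<and>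
      functor_comp (fundamental_gpd_on U R) T (inclusion_functor_on U X R) = P \<and>
      functor_comp (fundamental_gpd_on V R) T (inclusion_functor_on V X R) = Q"
      using T(1) by blast
  next
    fix T' assume T': "gpd_functor (fundamental_gpd_on X R) D T' \<and>
      functor_comp (fundamental_gpd_on U R) T' (inclusion_functor_on U X R) = P \<and>
      functor_comp (fundamental_gpd_on V R) T' (inclusion_functor_on V X R) = Q"
    then have T'P: "functor_comp (fundamental_gpd_on U R) T' (inclusion_functor_on U X R) = P"
      and T'Q: "functor_comp (fundamental_gpd_on V R) T' (inclusion_functor_on V X R) = Q"
      and T'F: "gpd_functor (fundamental_gpd_on X R) D T'" by simp_all
    \<comment> \<open>\<open>T'\<close> defines a cocycle on X by the same walks \<open>g\<close>.
      On each conjugated edge, which lies in U or in V, its value is prescribed by \<open>P\<close>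
      or \<open>Q\<close>; so its cocycle is \<open>e\<close>, and its values on walks over
      \<open>R\<close> are the products along them.\<close>
    interpret XF: based_functor X R g D T' by unfold_locales (use D T'F in auto)
    have ob': "ob x = XF.edge_ob x" if "x \<in> points X" for x
    proof (cases "x \<in> points U")
      case True
      then show ?thesis using functor_comp_inclusionD(1)[OF X U T'P U.g_end] by (simp add: obU)
    next
      case False
      then have "x \<in> points V" using that pX by simp
      then show ?thesis using functor_comp_inclusionD(1)[OF X V T'Q V.g_end] by (simp add: obV)
    qed
    have e': "e x y = XF.edge_arr x y" if xy: "{x, y} \<in> linked X" for x y
    proof -
      from xy lX consider "{x, y} \<in> linked U" | "{x, y} \<in> linked V" by blast
      then show ?thesis
      proof cases
        case 1
        then have "walk U [x, y]" by (simp add: walk_pair[OF scU])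
        then show ?thesis using functor_comp_inclusionD(2)[OF X U T'P U.based_walk(4)] 1 by (simp add: eU)
      next
        case 2
        then have "walk V [x, y]" by (simp add: walk_pair[OF scV])
        then show ?thesis using functor_comp_inclusionD(2)[OF X V T'Q V.based_walk(4)] 2 by (simp add: eV)
      qed
    qed
    have ext: "fst F \<in> extensional (R \<inter> points X)" "snd F \<in> extensional (path_class X ` walks_on X R)"
      if "gpd_functor (fundamental_gpd_on X R) D F" for F
      using that unfolding gpd_functor_def PiE_def Obj_on[OF X] Arr_on[OF X] by blast+
    show "T' = T"
    proof (rule prod_eqI)
      show "fst T' = fst T"
      proof (rule extensionalityI[OF ext(1)[OF T'F] ext(1)[OF T(1)]])
        fix x assume x: "x \<in> R \<inter> points X"
        then show "fst T' x = fst T x" using ob'[of x] g(1)[of x] by (simp add: T_def)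
      qed
      show "snd T' = snd T"
      proof (rule extensionalityI[OF ext(2)[OF T'F] ext(2)[OF T(1)]])
        fix \<alpha> assume "\<alpha> \<in> path_class X ` walks_on X R"
        then obtain w where w: "w \<in> walks_on X R" "\<alpha> = path_class X w" by blast
        then have "walk X w" by (simp add: walks_on_def)
        then have "C.prd w = snd T' (path_class X (based g w))" by (rule XF.walk_prod_eq[OF _ ob' e'])
        then show "snd T' \<alpha> = snd T \<alpha>" using w T(2)[OF w(1)] based_id[OF w(1)] by simp
      qed
    qed
  qed
qed

theorem mainTheorem2:
  fixes X U V :: "'a scomplex" and R :: "'a set"
  assumes "simplicial_complex X"
    and "subobject U X" and "subobject V X"
    and "X = sc_union U V"
    and "R \<subseteq> points X"
    and "representative R U" and "representative R V" and "representative R (sc_inter U V)"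
  shows "gpd_pushout TYPE('p) TYPE('n)
           (fundamental_gpd_on (sc_inter U V) R)
           (fundamental_gpd_on U R)
           (fundamental_gpd_on V R)
           (fundamental_gpd_on X R)
           (inclusion_functor_on (sc_inter U V) U R)
           (inclusion_functor_on (sc_inter U V) V R)
           (inclusion_functor_on U X R)
           (inclusion_functor_on V X R)"
proof -
  let ?W = "sc_inter U V"
  have scU: "simplicial_complex U" and scV: "simplicial_complex V"
    using assms(2,3) by (simp_all add: subobject_def)
  have scW: "simplicial_complex ?W" by (rule simplicial_complex_inter[OF scU scV])
  have WU: "subobject ?W U" and WV: "subobject ?W V"
    using scW by (auto simp: subobject_def sc_inter_def)
  show ?thesis
    unfolding gpd_pushout_def
  proof (intro conjI allI impI)
    show "functor_comp (fundamental_gpd_on ?W R) (inclusion_functor_on U X R) (inclusion_functor_on ?W U R) =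
        functor_comp (fundamental_gpd_on ?W R) (inclusion_functor_on V X R) (inclusion_functor_on ?W V R)"
      by (simp add: inclusion_functor_comp[OF assms(1,2) WU] inclusion_functor_comp[OF assms(1,3) WV])
  next
    fix D :: "('p, 'n) gpd" and P Q
    assume "groupoid D \<and> gpd_functor (fundamental_gpd_on U R) D P \<and> gpd_functor (fundamental_gpd_on V R) D Q \<and>
      functor_comp (fundamental_gpd_on ?W R) P (inclusion_functor_on ?W U R) =
      functor_comp (fundamental_gpd_on ?W R) Q (inclusion_functor_on ?W V R)"
    then show "\<exists>!T. gpd_functor (fundamental_gpd_on X R) D T \<and>
      functor_comp (fundamental_gpd_on U R) T (inclusion_functor_on U X R) = P \<and>
      functor_comp (fundamental_gpd_on V R) T (inclusion_functor_on V X R) = Q"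
      using van_kampen_universal[of U V R D P Q] assms by simp
  qed (use groupoid_on inclusion_functor scU scV scW WU WV assms(1-3) in auto)
qed

end
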